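(* For $\mu,\alpha\in\mathbb{R}$ and $\varepsilon\ge 0$ consider the linear $2\pi$-periodic Hamiltonian system with Hamiltonian $$H(\xi,\eta,\tau)=\tfrac12\eta^2-\tfrac12\left[\varepsilon\cos\tau+\alpha-\tfrac{\mu}{4}\right]\xi^2 ,$$ i.e. $\xi'=\eta$, $\eta'=\left(\varepsilon\cos\tau+\alpha-\frac{\mu}{4}\right)\xi$. For each $\mu\in\mathbb{R}$, the boundary between the stability and instability regions emanating from the resonance point $\alpha=\alpha_0=\frac{\mu-1}{4}$, $\varepsilon=0$ consists of the two curves $\alpha=\alpha_{-}(\mu,\varepsilon)$ and $\alpha=\alpha_{+}(\mu,\varepsilon)$ with, as $\varepsilon\to0^+$, $$\alpha_{\mp}(\mu,\varepsilon)=\frac{\mu-1}{4}\mp\frac12\varepsilon+\frac18\varepsilon^2\pm\frac1{32}\varepsilon^3+\frac1{384}\varepsilon^4\mp\frac{11}{4608}\varepsilon^5+\mathcal{O}(\varepsilon^6)$$ (upper signs for $\alpha_-$, lower signs for $\alpha_+$). The instability region associated with this resonance is the region between the two curves.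
   Context: The system is the linearization at the equilibrium $P_2=(\pi,0)$ of the charged pendulum with Hamiltonian $\frac12 y^2-\alpha\cos x-\varepsilon\cos\tau\cos x-\frac{\mu}{2}\log(7+\cos2x)$. A linear periodic system is stable if all its solutions are bounded for all $\tau\in\mathbb{R}$, and unstable otherwise. The point $(\mu,\alpha_0,0)$ is the resonance $2\omega=N$ with $N=1$, where $\omega^2=\frac{\mu}{4}-\alpha_0$. "The boundary emanating from $(\alpha_0,0)$ consists of the two curves $\alpha_\pm$, with instability region between them" means: there are $\varepsilon_0>0$ and $\delta>0$ (for fixed $\mu$) such that $\alpha_\pm(\mu,\cdot)$ are defined on $[0,\varepsilon_0)$, equal $\alpha_0$ at $\varepsilon=0$, and for $0<\varepsilon<\varepsilon_0$, $|\alpha-\alpha_0|<\delta$, the system is unstable when $\alpha$ lies strictly between the two curves and stable when $\alpha$ is strictly outside the closed interval they bound. As $\mu$ varies these curves form surfaces in the parameter space $(\mu,\alpha,\varepsilon)$. *)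

theory Defs
  imports "HOL-Analysis.Analysis" "HOL-Library.Landau_Symbols"
begin

text \<open>A one-degree-of-freedom time-dependent Hamiltonian is a function of \<open>\<xi>\<close>, \<open>\<eta>\<close>, \<open>\<tau>\<close>, in
  this order. Solutions are required to exist on the whole real line.\<close>

definition hamiltonian_solution ::
  "(real \<Rightarrow> real \<Rightarrow> real \<Rightarrow> real) \<Rightarrow> (real \<Rightarrow> real) \<Rightarrow> (real \<Rightarrow> real) \<Rightarrow> bool" where
  "hamiltonian_solution H \<xi> \<eta> \<longleftrightarrow>
     (\<forall>\<tau>. (\<xi> has_real_derivative deriv (\<lambda>y. H (\<xi> \<tau>) y \<tau>) (\<eta> \<tau>)) (at \<tau>) \<and>
          (\<eta> has_real_derivative - deriv (\<lambda>x. H x (\<eta> \<tau>) \<tau>) (\<xi> \<tau>)) (at \<tau>))"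

definition stable_system :: "(real \<Rightarrow> real \<Rightarrow> real \<Rightarrow> real) \<Rightarrow> bool" where
  "stable_system H \<longleftrightarrow>
     (\<forall>\<xi> \<eta>. hamiltonian_solution H \<xi> \<eta> \<longrightarrow> bounded (range (\<lambda>\<tau>. (\<xi> \<tau>, \<eta> \<tau>))))"

abbreviation unstable_system :: "(real \<Rightarrow> real \<Rightarrow> real \<Rightarrow> real) \<Rightarrow> bool" where
  "unstable_system H \<equiv> \<not> stable_system H"

definition pendulum_H :: "real \<Rightarrow> real \<Rightarrow> real \<Rightarrow> real \<Rightarrow> real \<Rightarrow> real \<Rightarrow> real" where
  "pendulum_H \<mu> \<alpha> \<epsilon> \<xi> \<eta> \<tau> = \<eta>\<^sup>2 / 2 - (\<epsilon> * cos \<tau> + \<alpha> - \<mu> / 4) * \<xi>\<^sup>2 / 2"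

lemma hamiltonian_solution_pendulum_H_iff:
  "hamiltonian_solution (pendulum_H \<mu> \<alpha> \<epsilon>) \<xi> \<eta> \<longleftrightarrow>
     (\<forall>\<tau>. (\<xi> has_real_derivative \<eta> \<tau>) (at \<tau>) \<and>
          (\<eta> has_real_derivative (\<epsilon> * cos \<tau> + \<alpha> - \<mu> / 4) * \<xi> \<tau>) (at \<tau>))"
proof -
  have "deriv (\<lambda>y. pendulum_H \<mu> \<alpha> \<epsilon> x y t) z = z" for x t z
    unfolding pendulum_H_def by (rule DERIV_imp_deriv) (auto intro!: derivative_eq_intros)
  moreover have "deriv (\<lambda>x. pendulum_H \<mu> \<alpha> \<epsilon> x y t) z = - ((\<epsilon> * cos t + \<alpha> - \<mu> / 4) * z)" for y t z
    unfolding pendulum_H_def by (rule DERIV_imp_deriv) (auto intro!: derivative_eq_intros)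
  ultimately show ?thesis
    by (simp add: hamiltonian_solution_def)
qed

text \<open>For a two-parameter family \<open>H \<alpha> \<epsilon>\<close>: the stability boundary emanating from \<open>(\<alpha>\<^sub>0, 0)\<close> consists
  of the curves \<open>\<alpha> = a \<epsilon>\<close> and \<open>\<alpha> = b \<epsilon>\<close>, with the instability region between them. The curves
  matter only on \<open>[0, \<epsilon>\<^sub>0)\<close>; segments are used because no order of the two curves is presupposed,
  and nothing is claimed on the curves themselves.\<close>

definition boundary_emanating_from ::
  "(real \<Rightarrow> real \<Rightarrow> real \<Rightarrow> real \<Rightarrow> real \<Rightarrow> real) \<Rightarrow> real \<Rightarrow> (real \<Rightarrow> real) \<Rightarrow> (real \<Rightarrow> real) \<Rightarrow> bool" where
  "boundary_emanating_from H \<alpha>\<^sub>0 a b \<longleftrightarrow>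
     (\<exists>\<epsilon>\<^sub>0>0. \<exists>\<delta>>0.
        continuous_on {0..<\<epsilon>\<^sub>0} a \<and> continuous_on {0..<\<epsilon>\<^sub>0} b \<and> a 0 = \<alpha>\<^sub>0 \<and> b 0 = \<alpha>\<^sub>0 \<and>
        (\<forall>\<epsilon> \<alpha>. 0 < \<epsilon> \<longrightarrow> \<epsilon> < \<epsilon>\<^sub>0 \<longrightarrow> \<bar>\<alpha> - \<alpha>\<^sub>0\<bar> < \<delta> \<longrightarrow>
           (\<alpha> \<in> open_segment (a \<epsilon>) (b \<epsilon>) \<longrightarrow> unstable_system (H \<alpha> \<epsilon>)) \<and>
           (\<alpha> \<notin> closed_segment (a \<epsilon>) (b \<epsilon>) \<longrightarrow> stable_system (H \<alpha> \<epsilon>))))"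

end

theory Submission
  imports Defs
begin

text \<open>With \<open>l = \<alpha> - (\<mu> - 1) / 4\<close> the system is the Mathieu equation
  \<open>x'' = (e cos t + l - 1/4) x\<close>. Since the potential is even and \<open>2\<pi>\<close>-periodic, its monodromy is
  determined by the half-period values \<open>c(\<pi>)\<close>, \<open>s(\<pi>)\<close>, \<open>c'(\<pi>)\<close>, \<open>s'(\<pi>)\<close>, and near the resonance the
  system is stable or unstable according to the sign of \<open>c(\<pi>) s'(\<pi>)\<close>. The half-period shift gives
  \<open>s'(\<pi>; l, e) = c(\<pi>; l, - e)\<close>, so both boundary curves come from one root curve \<open>l = f e\<close> of
  \<open>c(\<pi>; l, e)\<close>, namely \<open>f e\<close> and \<open>f (- e)\<close>. Wronskian identities replace the implicit function
  theorem: comparing two even solutions shows that \<open>c(\<pi>; l, e)\<close> changes sign exactly at the root and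
  that \<open>f\<close> is Lipschitz, and comparing with an explicit trigonometric polynomial that vanishes at \<open>\<pi>\<close>
  and solves the equation up to \<open>O(e\<^sup>6)\<close> locates the root up to \<open>O(e\<^sup>6)\<close>.\<close>

section \<open>Linear second-order equations\<close>

text \<open>Taylor coefficients at 0 of the solution of \<open>x'' = v x\<close> with
  \<open>x 0 = a\<close>, \<open>x' 0 = b\<close>, where \<open>V\<close> lists those of
  \<open>v\<close>.\<close>

fun ode_coeff :: "(nat \<Rightarrow> real) \<Rightarrow> real \<Rightarrow> real \<Rightarrow> nat \<Rightarrow> real" where
  "ode_coeff V a b 0 = a"
| "ode_coeff V a b (Suc 0) = b"
| "ode_coeff V a b (Suc (Suc n)) =
     (\<Sum>k\<le>n. V k * ode_coeff V a b (n - k)) / (real (Suc n) * real (Suc (Suc n)))"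

text \<open>The coefficients \<open>V\<close> decay faster than any geometric sequence, and the
  denominators of the recurrence eventually absorb the constant in that bound. So the solution
  coefficients decay like \<open>\<rho> ^ n\<close> with
  \<open>\<rho> * \<bar>x\<bar> < 1\<close>.\<close>

lemma summable_ode_coeff:
  assumes V: "\<And>x::real. summable (\<lambda>n. V n * x ^ n)"
  shows "summable (\<lambda>n. ode_coeff V a b n * x ^ n)"
proof -
  define u where "u = ode_coeff V a b"
  define \<rho> where "\<rho> = 1 / (2 * \<bar>x\<bar> + 1)"
  have \<rho>: "\<rho> > 0" "\<rho> * \<bar>x\<bar> < 1"
    by (auto simp: \<rho>_def divide_simps)
  have "Bseq (\<lambda>n. V n * (1 / \<rho>) ^ n)"
    by (rule convergent_imp_Bseq[OF convergentI[OF summable_LIMSEQ_zero[OF V]]])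
  then obtain W where W: "W > 0" "\<And>n. \<bar>V n * (1 / \<rho>) ^ n\<bar> \<le> W"
    by (auto simp: Bseq_def)
  have WV: "\<bar>V n\<bar> \<le> W * \<rho> ^ n" for n
    using W(2)[of n] \<rho>(1) by (simp add: abs_mult power_divide divide_simps)
  \<comment> \<open>For \<open>m > N\<close>, division by \<open>m + 2\<close> pays for the factor
    \<open>W\<close> and for the two powers of \<open>\<rho>\<close> missing between
    \<open>m\<close> and \<open>n = m + 2\<close>; the sum \<open>A\<close> covers the smaller
    indices.\<close>
  obtain N where N: "W / \<rho>\<^sup>2 \<le> real N"
    using real_arch_simple by blast
  define A where "A = (\<Sum>n\<le>N+2. \<bar>u n\<bar> / \<rho> ^ n)"
  have A0: "A \<ge> 0"
    unfolding A_def using \<rho> by (intro sum_nonneg) auto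
  have bound: "\<bar>u n\<bar> \<le> A * \<rho> ^ n" for n
  proof (induction n rule: less_induct)
    case (less n)
    show ?case
    proof (cases "n \<le> N + 2")
      case True
      have "\<bar>u n\<bar> / \<rho> ^ n \<le> A"
        unfolding A_def using \<rho> True by (intro member_le_sum) auto
      then show ?thesis using \<rho> by (simp add: divide_simps)
    next
      case False
      define m where "m = n - 2"
      have m: "n = Suc (Suc m)" "m > N" using False by (auto simp: m_def)
      have "\<bar>\<Sum>k\<le>m. V k * u (m - k)\<bar> \<le> (\<Sum>k\<le>m. (W * \<rho> ^ k) * (A * \<rho> ^ (m - k)))"
      proof (rule order_trans[OF sum_abs], rule sum_mono)
        fix k assume "k \<in> {..m}"
        then show "\<bar>V k * u (m - k)\<bar> \<le> (W * \<rho> ^ k) * (A * \<rho> ^ (m - k))"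
          unfolding abs_mult using less[of "m - k"] m W \<rho>
          by (intro mult_mono WV) auto
      qed
      also have "\<dots> = (\<Sum>k\<le>m. W * A * \<rho> ^ m)"
        by (intro sum.cong) (auto simp: power_add[symmetric])
      finally have S: "\<bar>\<Sum>k\<le>m. V k * u (m - k)\<bar> \<le> real (Suc m) * (W * A * \<rho> ^ m)"
        by simp
      have "\<bar>u n\<bar> = \<bar>\<Sum>k\<le>m. V k * u (m - k)\<bar> / (real (Suc m) * real (Suc (Suc m)))"
        unfolding u_def m by (simp add: abs_mult)
      also have "\<dots> \<le> real (Suc m) * (W * A * \<rho> ^ m) / (real (Suc m) * real (Suc (Suc m)))"
        using S by (intro divide_right_mono) auto
      also have "\<dots> = (W / real (Suc (Suc m))) * (A * \<rho> ^ m)"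
        by (simp del: of_nat_Suc)
      also have "\<dots> \<le> \<rho>\<^sup>2 * (A * \<rho> ^ m)"
      proof (rule mult_right_mono)
        have "W / \<rho>\<^sup>2 \<le> real (Suc (Suc m))" using N m by simp
        then show "W / real (Suc (Suc m)) \<le> \<rho>\<^sup>2"
          using \<rho> by (simp add: divide_simps mult.commute del: of_nat_Suc)
      qed (use A0 \<rho> in auto)
      also have "\<dots> = A * \<rho> ^ n" by (simp add: m power2_eq_square)
      finally show ?thesis .
    qed
  qed
  have "summable (\<lambda>n. A * (\<rho> * \<bar>x\<bar>) ^ n)"
    using \<rho> by (intro summable_mult summable_geometric) auto
  then show ?thesis
  proof (rule summable_comparison_test')
    fix n assume "n \<ge> (0::nat)"
    show "norm (ode_coeff V a b n * x ^ n) \<le> A * (\<rho> * \<bar>x\<bar>) ^ n"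
      using mult_right_mono[OF bound[of n], of "\<bar>x\<bar> ^ n"]
      by (simp add: u_def abs_mult power_abs power_mult_distrib mult.assoc)
  qed
qed

text \<open>The series with the recursive coefficients converges everywhere, and the Cauchy product
  of the two series turns the recurrence into the equation.\<close>

lemma entire_linear_ode_solution_exists:
  fixes V :: "nat \<Rightarrow> real"
  assumes V: "\<And>x. (\<lambda>n. V n * x ^ n) sums v x"
  obtains x y where
    "\<And>t. (x has_real_derivative y t) (at t)"
    "\<And>t. (y has_real_derivative v t * x t) (at t)"
    "x 0 = a" "y 0 = b"
proof
  define u where "u = ode_coeff V a b"
  have sV: "summable (\<lambda>n. V n * x ^ n)" for x
    using V sums_summable by blast
  have su: "summable (\<lambda>n. u n * x ^ n)" for x
    unfolding u_def by (rule summable_ode_coeff) (rule sV)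
  have sdu: "summable (\<lambda>n. diffs u n * x ^ n)" for x
    by (rule termdiff_converges_all) (rule su)
  show "((\<lambda>t. \<Sum>n. u n * t ^ n) has_real_derivative (\<Sum>n. diffs u n * t ^ n)) (at t)" for t
    by (rule termdiffs_strong[OF su, where K = "\<bar>t\<bar> + 1"]) auto
  have "((\<lambda>t. \<Sum>n. diffs u n * t ^ n) has_real_derivative (\<Sum>n. diffs (diffs u) n * t ^ n)) (at t)" for t
    by (rule termdiffs_strong[OF sdu, where K = "\<bar>t\<bar> + 1"]) auto
  moreover have "(\<Sum>n. diffs (diffs u) n * t ^ n) = v t * (\<Sum>n. u n * t ^ n)" for t
  proof -
    have "v t * (\<Sum>n. u n * t ^ n) = (\<Sum>n. V n * t ^ n) * (\<Sum>n. u n * t ^ n)"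
      using V[of t] by (simp add: sums_iff)
    also have "\<dots> = (\<Sum>n. \<Sum>k\<le>n. (V k * t ^ k) * (u (n - k) * t ^ (n - k)))"
      by (rule Cauchy_product; rule powser_insidea[where x = "\<bar>t\<bar> + 1"]) (auto intro: su sV)
    also have "\<dots> = (\<Sum>n. diffs (diffs u) n * t ^ n)"
    proof (rule suminf_cong)
      fix n
      have "(\<Sum>k\<le>n. (V k * t ^ k) * (u (n - k) * t ^ (n - k))) = (\<Sum>k\<le>n. V k * u (n - k) * t ^ n)"
        by (intro sum.cong) (auto simp: power_add[symmetric])
      also have "\<dots> = diffs (diffs u) n * t ^ n"
        by (simp add: diffs_def u_def sum_distrib_right del: of_nat_Suc)
      finally show "(\<Sum>k\<le>n. (V k * t ^ k) * (u (n - k) * t ^ (n - k))) = diffs (diffs u) n * t ^ n" .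
    qed
    finally show ?thesis by simp
  qed
  ultimately show "((\<lambda>t. \<Sum>n. diffs u n * t ^ n) has_real_derivative v t * (\<Sum>n. u n * t ^ n)) (at t)" for t
    by simp
  show "(\<Sum>n. u n * 0 ^ n) = a" "(\<Sum>n. diffs u n * 0 ^ n) = b"
    by (simp_all only: powser_zero) (simp_all add: u_def diffs_def)
qed

text \<open>Energy estimate: the derivative of \<open>d\<^sup>2 + e\<^sup>2\<close> is at most
  \<open>(K + 2) * (d\<^sup>2 + e\<^sup>2) + \<gamma>\<^sup>2\<close>, so the energy, shifted by
  \<open>\<gamma>\<^sup>2 / (K + 2)\<close> to absorb the constant, grows at most like
  \<open>exp ((K + 2) * t)\<close>.\<close>

lemma gronwall_second_order:
  fixes d e q :: "real \<Rightarrow> real"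
  assumes d: "\<And>t. 0 \<le> t \<Longrightarrow> t \<le> T \<Longrightarrow> (d has_real_derivative e t) (at t)"
    and e: "\<And>t. 0 \<le> t \<Longrightarrow> t \<le> T \<Longrightarrow> (e has_real_derivative q t) (at t)"
    and q: "\<And>t. 0 \<le> t \<Longrightarrow> t \<le> T \<Longrightarrow> \<bar>q t\<bar> \<le> K * \<bar>d t\<bar> + \<gamma>"
    and init: "d 0 = 0" "e 0 = 0" and T: "0 \<le> T" and K: "0 \<le> K" "0 \<le> \<gamma>"
  shows "(d T)\<^sup>2 + (e T)\<^sup>2 \<le> \<gamma>\<^sup>2 * exp ((K + 2) * T)"
proof -
  define F where "F t = ((d t)\<^sup>2 + (e t)\<^sup>2 + \<gamma>\<^sup>2 / (K + 2)) * exp (- (K + 2) * t)" for t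
  have "F T \<le> F 0"
  proof (rule DERIV_nonpos_imp_nonincreasing[OF T])
    fix t assume t: "0 \<le> t" "t \<le> T"
    let ?E = "(d t)\<^sup>2 + (e t)\<^sup>2"
    have "2 * d t * e t + 2 * e t * q t \<le> (K + 2) * ?E + \<gamma>\<^sup>2"
    proof -
      define m r S where "m = \<bar>d t\<bar> * \<bar>e t\<bar>" and "r = \<bar>e t\<bar> * \<gamma>" and "S = ?E"
      have m: "2 * m \<le> S" "d t * e t \<le> m"
        using sum_squares_bound[of "\<bar>d t\<bar>" "\<bar>e t\<bar>"] abs_ge_self[of "d t * e t"]
        by (simp_all add: m_def S_def abs_mult)
      have "e t * q t \<le> \<bar>e t\<bar> * (K * \<bar>d t\<bar> + \<gamma>)"
        using mult_left_mono[OF q[OF t], of "\<bar>e t\<bar>"] abs_ge_self[of "e t * q t"]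
        by (simp add: abs_mult)
      then have "e t * q t \<le> K * m + r"
        by (simp add: m_def r_def algebra_simps)
      moreover have "2 * r \<le> (e t)\<^sup>2 + \<gamma>\<^sup>2"
        using sum_squares_bound[of "\<bar>e t\<bar>" \<gamma>] by (simp add: r_def)
      moreover have "2 * (K * m) \<le> K * S"
        using mult_left_mono[OF m(1) K(1)] by simp
      moreover have "(e t)\<^sup>2 \<le> S" by (simp add: S_def)
      ultimately have "2 * (d t * e t) + 2 * (e t * q t) \<le> K * S + 2 * S + \<gamma>\<^sup>2"
        using m by linarith
      then show ?thesis by (simp add: S_def algebra_simps)
    qed
    moreover have "(K + 2) * (?E + \<gamma>\<^sup>2 / (K + 2)) = (K + 2) * ?E + \<gamma>\<^sup>2"
      using K by (simp add: distrib_left)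
    ultimately have "(2 * d t * e t + 2 * e t * q t - (K + 2) * (?E + \<gamma>\<^sup>2 / (K + 2))) * exp (- (K + 2) * t) \<le> 0"
      by (intro mult_nonpos_nonneg) auto
    moreover have "(F has_real_derivative
        (2 * d t * e t + 2 * e t * q t - (K + 2) * (?E + \<gamma>\<^sup>2 / (K + 2))) * exp (- (K + 2) * t)) (at t)"
      unfolding F_def
      by (rule derivative_eq_intros d[OF t] e[OF t] refl)+ (simp add: algebra_simps power2_eq_square add_divide_distrib)
    ultimately show "\<exists>y. (F has_real_derivative y) (at t) \<and> y \<le> 0" by blast
  qed
  then have "((d T)\<^sup>2 + (e T)\<^sup>2 + \<gamma>\<^sup>2 / (K + 2)) * exp (- (K + 2) * T) * exp ((K + 2) * T)
      \<le> \<gamma>\<^sup>2 / (K + 2) * exp ((K + 2) * T)"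
    unfolding F_def by (intro mult_right_mono) (simp_all add: init)
  also have "\<dots> \<le> \<gamma>\<^sup>2 * exp ((K + 2) * T)"
    using K mult_left_mono[of 1 "K + 2" "\<gamma>\<^sup>2"] by (intro mult_right_mono) (auto simp: divide_simps)
  also have "exp (- (K + 2) * T) * exp ((K + 2) * T) = 1"
    by (simp add: algebra_simps flip: exp_add)
  then have "((d T)\<^sup>2 + (e T)\<^sup>2 + \<gamma>\<^sup>2 / (K + 2)) * exp (- (K + 2) * T) * exp ((K + 2) * T)
      = (d T)\<^sup>2 + (e T)\<^sup>2 + \<gamma>\<^sup>2 / (K + 2)"
    by (simp add: mult.assoc)
  finally have "(d T)\<^sup>2 + (e T)\<^sup>2 + \<gamma>\<^sup>2 / (K + 2) \<le> \<gamma>\<^sup>2 * exp ((K + 2) * T)" .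
  moreover have "0 \<le> \<gamma>\<^sup>2 / (K + 2)" using K by simp
  ultimately show ?thesis by linarith
qed

section \<open>Stability of the Mathieu equation\<close>

text \<open>The constant \<open>1/4\<close> puts the resonance at \<open>l = e = 0\<close>, where
  the equation is \<open>x'' = - x / 4\<close>.\<close>

definition mathieu_sol :: "real \<Rightarrow> real \<Rightarrow> (real \<Rightarrow> real) \<Rightarrow> (real \<Rightarrow> real) \<Rightarrow> bool" where
  "mathieu_sol l e x y \<longleftrightarrow>
     (\<forall>t. (x has_real_derivative y t) (at t) \<and>
          (y has_real_derivative (e * cos t + l - 1/4) * x t) (at t))"

lemma hamiltonian_solution_pendulum_H_iff_mathieu_sol:
  "hamiltonian_solution (pendulum_H \<mu> \<alpha> \<epsilon>) = mathieu_sol (\<alpha> - (\<mu> - 1) / 4) \<epsilon>"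
proof -
  have *: "\<epsilon> * cos t + (\<alpha> - (\<mu> - 1) / 4) - 1/4 = \<epsilon> * cos t + \<alpha> - \<mu> / 4" for t
    by (simp add: field_simps)
  show ?thesis
    unfolding hamiltonian_solution_pendulum_H_iff mathieu_sol_def fun_eq_iff * by blast
qed

lemma mathieu_solD:
  assumes "mathieu_sol l e x y"
  shows "(x has_real_derivative y t) (at t)"
    "(y has_real_derivative (e * cos t + l - 1/4) * x t) (at t)"
  using assms by (auto simp: mathieu_sol_def)

lemma mathieu_sol_exists:
  obtains x y where "mathieu_sol l e x y" "x 0 = a" "y 0 = b"
proof -
  have "(\<lambda>n. e * (cos_coeff n * x ^ n) + (if n = 0 then l - 1/4 else 0) * x ^ n)
      sums (e * cos x + (l - 1/4))" for x
  proof (intro sums_add sums_mult)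
    show "(\<lambda>n. cos_coeff n * x ^ n) sums cos x"
      using cos_converges[of x] by simp
    show "(\<lambda>n. (if n = 0 then l - 1/4 else 0) * x ^ n) sums (l - 1/4)"
      using sums_single[of 0 "\<lambda>_. l - 1/4"] by (rule back_subst[where P = "\<lambda>f. f sums _"]) auto
  qed
  then have "(\<lambda>n. (e * cos_coeff n + (if n = 0 then l - 1/4 else 0)) * x ^ n)
      sums (e * cos x + l - 1/4)" for x
    by (simp add: algebra_simps)
  from entire_linear_ode_solution_exists[OF this, of a b] show ?thesis
    using that unfolding mathieu_sol_def by metis
qed

lemma mathieu_sol_lincomb:
  assumes "mathieu_sol l e x y" "mathieu_sol l e u v"
  shows "mathieu_sol l e (\<lambda>t. a * x t + b * u t) (\<lambda>t. a * y t + b * v t)"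
  unfolding mathieu_sol_def
  by (intro allI conjI; (rule derivative_eq_intros assms[THEN mathieu_solD(1)] assms[THEN mathieu_solD(2)] refl)+)
     (simp_all add: algebra_simps)

lemma mathieu_sol_reflect:
  assumes "mathieu_sol l e x y"
  shows "mathieu_sol l e (\<lambda>t. x (- t)) (\<lambda>t. - y (- t))"
  unfolding mathieu_sol_def
proof (intro allI conjI)
  fix t
  have m: "((\<lambda>t. - t) has_real_derivative -1) (at t)"
    by (auto intro!: derivative_eq_intros)
  show "((\<lambda>t. x (- t)) has_real_derivative - y (- t)) (at t)"
    using DERIV_chain2[OF mathieu_solD(1)[OF assms, of "- t"] m] by simp
  show "((\<lambda>t. - y (- t)) has_real_derivative (e * cos t + l - 1/4) * x (- t)) (at t)"
    using DERIV_minus[OF DERIV_chain2[OF mathieu_solD(2)[OF assms, of "- t"] m]] by simp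
qed

text \<open>Since \<open>cos (t + pi) = - cos t\<close>, half a period exchanges \<open>e\<close>
  and \<open>- e\<close>; this symmetry lets one root curve serve for both boundary curves.\<close>

lemma mathieu_sol_shift_pi:
  assumes "mathieu_sol l e x y"
  shows "mathieu_sol l (- e) (\<lambda>t. x (t + pi)) (\<lambda>t. y (t + pi))"
  unfolding mathieu_sol_def
  using mathieu_solD[OF assms, of "_ + pi"] by (simp add: DERIV_shift)

lemma mathieu_sol_shift_period:
  assumes "mathieu_sol l e x y"
  shows "mathieu_sol l e (\<lambda>t. x (t + 2 * pi)) (\<lambda>t. y (t + 2 * pi))"
  using mathieu_sol_shift_pi[OF mathieu_sol_shift_pi[OF assms]] by (simp add: add.assoc)

lemma mathieu_sol_reflect_period:
  assumes "mathieu_sol l e x y"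
  shows "mathieu_sol l e (\<lambda>t. x (2 * pi - t)) (\<lambda>t. - y (2 * pi - t))"
  using mathieu_sol_reflect[OF mathieu_sol_shift_period[OF assms]] by (simp add: algebra_simps)

text \<open>Uniqueness: forward in time by the Gronwall estimate with zero forcing, backward by
  reflection.\<close>

lemma mathieu_sol_zero:
  assumes xy: "mathieu_sol l e x y" and "x 0 = 0" "y 0 = 0"
  shows "x t = 0 \<and> y t = 0"
proof -
  have *: "u t = 0 \<and> v t = 0" if uv: "mathieu_sol l e u v" "u 0 = 0" "v 0 = 0" "0 \<le> t" for u v t
  proof -
    have "(u t)\<^sup>2 + (v t)\<^sup>2 \<le> 0\<^sup>2 * exp ((\<bar>e\<bar> + \<bar>l\<bar> + 1 + 2) * t)"
    proof (rule gronwall_second_order[OF mathieu_solD[OF uv(1)] _ uv(2-4)])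
      fix s :: real
      have "\<bar>e * cos s\<bar> \<le> \<bar>e\<bar>" by (simp add: abs_mult mult_left_le)
      then have "\<bar>e * cos s + l - 1/4\<bar> \<le> \<bar>e\<bar> + \<bar>l\<bar> + 1" by linarith
      then show "\<bar>(e * cos s + l - 1/4) * u s\<bar> \<le> (\<bar>e\<bar> + \<bar>l\<bar> + 1) * \<bar>u s\<bar> + 0"
        unfolding abs_mult by (simp add: mult_right_mono)
    qed auto
    then show ?thesis by (simp add: sum_power2_le_zero_iff)
  qed
  show ?thesis
  proof (cases "0 \<le> t")
    case False
    then show ?thesis
      using *[OF mathieu_sol_reflect[OF xy], of "- t"] assms by auto
  qed (use * assms in blast)
qed

section \<open>Monodromy and the stability criterion\<close>

locale mathieu_fundamental =
  fixes l e :: real and c c' s s' :: "real \<Rightarrow> real"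
  assumes c: "mathieu_sol l e c c'" "c 0 = 1" "c' 0 = 0"
    and s: "mathieu_sol l e s s'" "s 0 = 0" "s' 0 = 1"
begin

text \<open>The difference of the two sides is a solution with zero initial data.\<close>

lemma representation:
  assumes "mathieu_sol l e x y"
  shows "x t = x 0 * c t + y 0 * s t" "y t = x 0 * c' t + y 0 * s' t"
  using mathieu_sol_zero[OF mathieu_sol_lincomb[OF assms
        mathieu_sol_lincomb[OF c(1) s(1), of "x 0" "y 0"], of 1 "-1"], of t]
  by (simp_all add: c s algebra_simps)

lemma wronskian: "c t * s' t - s t * c' t = 1"
proof -
  have "((\<lambda>t. c t * s' t - s t * c' t) has_real_derivative 0) (at t)" for t
    by (rule derivative_eq_intros mathieu_solD[OF c(1)] mathieu_solD[OF s(1)] refl)+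
       (simp add: algebra_simps)
  then have "c t * s' t - s t * c' t = c 0 * s' 0 - s 0 * c' 0"
    by (rule DERIV_isconst_all[rule_format, rotated]) 
  then show ?thesis by (simp add: c s)
qed

text \<open>Expand \<open>c (2 * pi - t)\<close> and \<open>s (2 * pi - t)\<close> in the fundamental system and evaluate at
  \<open>t = pi\<close>: the entries of the monodromy solve the resulting linear equations.\<close>

lemma monodromy:
  "c (2 * pi) = c pi * s' pi + s pi * c' pi" "c' (2 * pi) = 2 * c pi * c' pi"
  "s (2 * pi) = 2 * s pi * s' pi" "s' (2 * pi) = c pi * s' pi + s pi * c' pi"
proof -
  note W = wronskian[of pi]
  have 1: "c pi = c (2 * pi) * c pi - c' (2 * pi) * s pi"
    "- c' pi = c (2 * pi) * c' pi - c' (2 * pi) * s' pi"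
    using representation[OF mathieu_sol_reflect_period[OF c(1)], of pi] by simp_all
  have 2: "s pi = s (2 * pi) * c pi - s' (2 * pi) * s pi"
    "- s' pi = s (2 * pi) * c' pi - s' (2 * pi) * s' pi"
    using representation[OF mathieu_sol_reflect_period[OF s(1)], of pi] by simp_all
  show "c (2 * pi) = c pi * s' pi + s pi * c' pi" using 1 W by algebra
  show "c' (2 * pi) = 2 * c pi * c' pi" using 1 W by algebra
  show "s (2 * pi) = 2 * s pi * s' pi" using 2 W by algebra
  show "s' (2 * pi) = c pi * s' pi + s pi * c' pi" using 2 W by algebra
qed

text \<open>With the Wronskian, \<open>c (2 * pi) = 2 * c pi * s' pi - 1 < -1\<close>. This is half
  the trace of the monodromy, so the multipliers are real and off the unit circle.\<close>

lemma unbounded_c: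
  assumes "c pi * s' pi < 0"
  shows "\<not> bounded (range (\<lambda>t. (c t, c' t)))"
proof
  assume "bounded (range (\<lambda>t. (c t, c' t)))"
  then obtain M where M: "\<And>t. \<bar>c t\<bar> \<le> M"
    unfolding bounded_iff by (metis UNIV_I image_eqI norm_fst_le order_trans real_norm_def)
  define A where "A = c (2 * pi)"
  have A: "\<bar>A\<bar> > 1"
    using wronskian[of pi] assms unfolding A_def monodromy by linarith
  text \<open>Evenness gives the three-term recurrence \<open>c (t + 2\<pi>) + c (t - 2\<pi>) = 2 A c t\<close>, which grows
    geometrically when \<open>\<bar>A\<bar> > 1\<close>.\<close>
  have even: "c (- t) = c t" for t
    using representation(1)[OF mathieu_sol_reflect[OF c(1)], of t] c by simp
  have rec: "c (t + 2 * pi) = 2 * A * c t - c (t - 2 * pi)" for t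
    using representation(1)[OF mathieu_sol_shift_period[OF c(1)], of t]
      representation(1)[OF mathieu_sol_reflect_period[OF c(1)], of t] even[of "2 * pi - t"]
    by (simp add: A_def algebra_simps)
  \<comment> \<open>By the recurrence the next value is at least \<open>2 * \<bar>A\<bar>\<close>
    times the current one minus the previous one, and the previous one is at most
    \<open>\<bar>A\<bar>\<close> times the current one.\<close>
  have grow: "\<bar>A\<bar> * \<bar>c (2 * pi * real n)\<bar> \<le> \<bar>c (2 * pi * real (Suc n))\<bar>" for n
  proof (induction n)
    case 0
    show ?case by (simp add: A_def c)
  next
    case (Suc n)
    have "c (2 * pi * real (Suc (Suc n))) = 2 * A * c (2 * pi * real (Suc n)) - c (2 * pi * real n)"
      using rec[of "2 * pi * real (Suc n)"] by (simp add: algebra_simps)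
    then have "\<bar>c (2 * pi * real (Suc (Suc n)))\<bar>
        \<ge> 2 * (\<bar>A\<bar> * \<bar>c (2 * pi * real (Suc n))\<bar>) - \<bar>c (2 * pi * real n)\<bar>"
      using abs_mult[of A "c (2 * pi * real (Suc n))"] by linarith
    moreover have "\<bar>c (2 * pi * real n)\<bar> \<le> \<bar>A\<bar> * \<bar>c (2 * pi * real n)\<bar>"
      "\<bar>c (2 * pi * real (Suc n))\<bar> \<le> \<bar>A\<bar> * \<bar>c (2 * pi * real (Suc n))\<bar>"
      using A mult_right_mono[of 1 "\<bar>A\<bar>"] by simp_all
    ultimately show ?case using Suc by linarith
  qed
  have pow: "\<bar>A\<bar> ^ n \<le> \<bar>c (2 * pi * real n)\<bar>" for n
  proof (induction n)
    case (Suc n)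
    then have "\<bar>A\<bar> * \<bar>A\<bar> ^ n \<le> \<bar>A\<bar> * \<bar>c (2 * pi * real n)\<bar>"
      by (intro mult_left_mono) auto
    also note grow[of n]
    finally show ?case by simp
  qed (simp add: c)
  obtain n where "M < \<bar>A\<bar> ^ n" using real_arch_pow[OF A] by blast
  with pow[of n] M[of "2 * pi * real n"] show False by linarith
qed

text \<open>The elliptic case: an invariant definite quadratic form bounds the solution at multiples
  of the period, and compactness of one period bounds it in between.\<close>

lemma bounded_forward:
  assumes pt: "0 < c pi * s' pi" "c pi * s' pi < 1" and xy: "mathieu_sol l e x y"
  shows "\<exists>M. \<forall>t\<ge>0. \<bar>x t\<bar> \<le> M \<and> \<bar>y t\<bar> \<le> M"
proof -
  define A B C where "A = c (2 * pi)" and "B = s (2 * pi)" and "C = c' (2 * pi)"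
  have det: "A\<^sup>2 - B * C = 1"
    unfolding A_def B_def C_def monodromy using wronskian[of pi] by algebra
  have "B * C = 4 * ((c pi * s' pi) * (s pi * c' pi))"
    unfolding B_def C_def monodromy by simp
  \<comment> \<open>The Wronskian gives \<open>s pi * c' pi = c pi * s' pi - 1 < 0\<close>.\<close>
  also have "\<dots> < 0"
    using pt wronskian[of pi] by (simp add: mult_pos_neg)
  finally have BC: "B * C < 0" .
  then have C: "C \<noteq> 0" by auto
  define X Y where "X n = x (2 * pi * real n)" and "Y n = y (2 * pi * real n)" for n
  have sol: "mathieu_sol l e (\<lambda>t. x (t + 2 * pi * real n)) (\<lambda>t. y (t + 2 * pi * real n))" for n
  proof (induction n)
    case (Suc n)
    show ?case using mathieu_sol_shift_period[OF Suc] by (simp add: algebra_simps)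
  qed (use xy in simp)
  have shifted: "x (t + 2 * pi * real n) = X n * c t + Y n * s t"
    "y (t + 2 * pi * real n) = X n * c' t + Y n * s' t" for t n
    using representation[OF sol, where t = t and n1 = n] by (simp_all add: X_def Y_def)
  have step: "X (Suc n) = A * X n + B * Y n" "Y (Suc n) = C * X n + A * Y n" for n
    using shifted[of "2 * pi" n] monodromy unfolding X_def Y_def A_def B_def C_def
    by (simp_all add: algebra_simps)
  text \<open>The monodromy \<open>[[A, B], [C, A]]\<close> preserves \<open>C X\<^sup>2 - B Y\<^sup>2\<close>, which is definite as
    \<open>B C < 0\<close>.\<close>
  define Q where "Q = C * (X 0)\<^sup>2 - B * (Y 0)\<^sup>2"
  have inv: "C * (X n)\<^sup>2 - B * (Y n)\<^sup>2 = Q" for n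
  proof (induction n)
    case (Suc n)
    have "C * (X (Suc n))\<^sup>2 - B * (Y (Suc n))\<^sup>2 = (A\<^sup>2 - B * C) * (C * (X n)\<^sup>2 - B * (Y n)\<^sup>2)"
      unfolding step by algebra
    then show ?case using Suc det by simp
  qed (simp add: Q_def)
  \<comment> \<open>Multiplying by \<open>C\<close> makes both coefficients positive, whatever the
    sign of \<open>C\<close>.\<close>
  have pos: "C\<^sup>2 * (X n)\<^sup>2 + (- (B * C)) * (Y n)\<^sup>2 = C * Q" for n
    unfolding inv[of n, symmetric] by (simp add: algebra_simps power2_eq_square)
  define K where "K = sqrt (C * Q / C\<^sup>2) + sqrt (C * Q / (- (B * C)))"
  have CQ: "0 \<le> C * Q"
    using pos[of 0] BC by (metis add_nonneg_nonneg less_le mult_nonneg_nonneg neg_0_less_iff_less zero_le_power2)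
  have XY: "\<bar>X n\<bar> \<le> K" "\<bar>Y n\<bar> \<le> K" for n
  proof -
    have nn: "0 \<le> C\<^sup>2 * (X n)\<^sup>2" "0 \<le> (- (B * C)) * (Y n)\<^sup>2"
      using BC by (simp_all add: mult_nonpos_nonneg less_imp_le)
    have "C\<^sup>2 * (X n)\<^sup>2 \<le> C * Q" "(- (B * C)) * (Y n)\<^sup>2 \<le> C * Q"
      using pos[of n] nn by linarith+
    then have "(X n)\<^sup>2 \<le> C * Q / C\<^sup>2" "(Y n)\<^sup>2 \<le> C * Q / (- (B * C))"
      using C BC by (subst pos_le_divide_eq; simp add: mult.commute)+
    then have "\<bar>X n\<bar> \<le> sqrt (C * Q / C\<^sup>2)" "\<bar>Y n\<bar> \<le> sqrt (C * Q / (- (B * C)))"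
      by (metis real_sqrt_le_iff real_sqrt_abs)+
    moreover have "0 \<le> sqrt (C * Q / C\<^sup>2)" "0 \<le> sqrt (C * Q / (- (B * C)))"
      using CQ BC by (intro real_sqrt_ge_zero divide_nonneg_nonneg; simp)+
    ultimately show "\<bar>X n\<bar> \<le> K" "\<bar>Y n\<bar> \<le> K" unfolding K_def by linarith+
  qed
  have "\<exists>L. \<forall>t\<in>{0..2*pi}. \<bar>c t\<bar> + \<bar>s t\<bar> + \<bar>c' t\<bar> + \<bar>s' t\<bar> \<le> L"
  proof -
    have "continuous_on {0..2*pi} f" if "\<And>t. (f has_real_derivative f' t) (at t)" for f f' :: "real \<Rightarrow> real"
      using that by (meson DERIV_isCont continuous_at_imp_continuous_on)
    note cont = this[OF mathieu_solD(1)[OF c(1)]] this[OF mathieu_solD(2)[OF c(1)]]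
      this[OF mathieu_solD(1)[OF s(1)]] this[OF mathieu_solD(2)[OF s(1)]]
    have "compact ((\<lambda>t. \<bar>c t\<bar> + \<bar>s t\<bar> + \<bar>c' t\<bar> + \<bar>s' t\<bar>) ` {0..2*pi})"
      by (intro compact_continuous_image continuous_intros cont) simp
    then have "bounded ((\<lambda>t. \<bar>c t\<bar> + \<bar>s t\<bar> + \<bar>c' t\<bar> + \<bar>s' t\<bar>) ` {0..2*pi})"
      by (rule compact_imp_bounded)
    then show ?thesis
      unfolding bounded_iff by (auto dest!: abs_le_D1)
  qed
  then obtain L where L: "\<And>t. t \<in> {0..2*pi} \<Longrightarrow> \<bar>c t\<bar> + \<bar>s t\<bar> + \<bar>c' t\<bar> + \<bar>s' t\<bar> \<le> L"
    by blast
  have "\<bar>x t\<bar> \<le> K * L \<and> \<bar>y t\<bar> \<le> K * L" if "t \<ge> 0" for t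
  proof -
    \<comment> \<open>Reduction to \<open>r\<close> in a single period: the solution there starts
      from the bounded data \<open>X n\<close>, \<open>Y n\<close>.\<close>
    define n where "n = nat \<lfloor>t / (2 * pi)\<rfloor>"
    define r where "r = t - 2 * pi * real n"
    have "real n = of_int \<lfloor>t / (2 * pi)\<rfloor>" using that by (simp add: n_def)
    then have "real n \<le> t / (2 * pi)" "t / (2 * pi) < real n + 1" by linarith+
    then have r: "r \<in> {0..2*pi}"
      by (simp add: r_def field_simps)
    have K0: "0 \<le> K" using XY(1)[of 0] by linarith
    have aux: "\<bar>X n * u + Y n * v\<bar> \<le> K * L" if "\<bar>u\<bar> + \<bar>v\<bar> \<le> L" for u v
    proof -
      have "\<bar>X n * u + Y n * v\<bar> \<le> \<bar>X n\<bar> * \<bar>u\<bar> + \<bar>Y n\<bar> * \<bar>v\<bar>"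
        using abs_triangle_ineq[of "X n * u" "Y n * v"] by (simp add: abs_mult)
      also have "\<dots> \<le> K * \<bar>u\<bar> + K * \<bar>v\<bar>"
        by (intro add_mono mult_right_mono XY) auto
      also have "\<dots> \<le> K * L"
        using mult_left_mono[OF that K0] by (simp add: algebra_simps)
      finally show ?thesis .
    qed
    show ?thesis
      using shifted[of r n] L[OF r] aux[of "c r" "s r"] aux[of "c' r" "s' r"] by (simp add: r_def)
  qed
  then show ?thesis by blast
qed

lemma bounded_solution:
  assumes "0 < c pi * s' pi" "c pi * s' pi < 1" "mathieu_sol l e x y"
  shows "bounded (range (\<lambda>t. (x t, y t)))"
proof -
  obtain M where M: "\<And>t. t \<ge> 0 \<Longrightarrow> \<bar>x t\<bar> \<le> M \<and> \<bar>y t\<bar> \<le> M"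
    using bounded_forward[OF assms] by blast
  obtain N where N: "\<And>t. t \<ge> 0 \<Longrightarrow> \<bar>x (- t)\<bar> \<le> N \<and> \<bar>- y (- t)\<bar> \<le> N"
    using bounded_forward[OF assms(1,2) mathieu_sol_reflect[OF assms(3)]] by blast
  have "\<bar>x t\<bar> \<le> max M N \<and> \<bar>y t\<bar> \<le> max M N" for t
    using M[of t] N[of "- t"] by (cases "t \<ge> 0") (auto simp: le_max_iff_disj)
  then have "norm (x t, y t) \<le> max M N + max M N" for t
    using norm_Pair_le[of "x t" "y t"] by (smt (verit) real_norm_def)
  then show ?thesis
    unfolding bounded_iff by blast
qed

lemma stable_system_if:
  assumes "0 < c pi * s' pi" "c pi * s' pi < 1" "l = \<alpha> - (\<mu> - 1) / 4"
  shows "stable_system (pendulum_H \<mu> \<alpha> e)"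
  using bounded_solution assms
  unfolding stable_system_def hamiltonian_solution_pendulum_H_iff_mathieu_sol by blast

lemma unstable_system_if:
  assumes "c pi * s' pi < 0" "l = \<alpha> - (\<mu> - 1) / 4"
  shows "unstable_system (pendulum_H \<mu> \<alpha> e)"
  using unbounded_c c assms
  unfolding stable_system_def hamiltonian_solution_pendulum_H_iff_mathieu_sol by blast

text \<open>The function \<open>k (pi - t)\<close> solves the equation for \<open>e\<close>.
  Expanding it in the fundamental system and evaluating at \<open>pi\<close>, where its data are
  \<open>1\<close> and \<open>0\<close>, gives two linear equations for \<open>k pi\<close> and
  \<open>k' pi\<close>.\<close>

lemma s'_pi_eq_even_solution_shifted:
  assumes k: "mathieu_sol l (- e) k k'" "k 0 = 1" "k' 0 = 0"
  shows "s' pi = k pi"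
proof -
  have w: "mathieu_sol l e (\<lambda>t. k (pi - t)) (\<lambda>t. - k' (pi - t))"
    using mathieu_sol_reflect[OF mathieu_sol_shift_pi[OF k(1)]] by (simp add: algebra_simps)
  have "1 = k pi * c pi - k' pi * s pi" "0 = k pi * c' pi - k' pi * s' pi"
    using representation[OF w, of pi] k by simp_all
  then show ?thesis using wronskian[of pi] by algebra
qed

end

section \<open>An approximate antiperiodic solution\<close>

text \<open>Taylor polynomial of degree 5 of \<open>(1 - a1 (2 * e)) / 4\<close>, where
  \<open>a1\<close> is the characteristic value of the Mathieu function ce_1. Replacing
  \<open>e\<close> by \<open>- e\<close> gives the other boundary expansion.\<close>

definition lambda_approx :: "real \<Rightarrow> real" where
  "lambda_approx e = - e / 2 + e ^ 2 / 8 + e ^ 3 / 32 + e ^ 4 / 384 - 11 / 4608 * e ^ 5"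

text \<open>Fourier coefficients of the approximate solution divided by \<open>e\<close>, so that
  its distance \<open>O(e)\<close> from \<open>cos (t / 2)\<close> is explicit. The guard is needed
  because \<open>!\<close> is unspecified beyond the list.\<close>

definition approx_tail :: "real \<Rightarrow> nat \<Rightarrow> real" where
  "approx_tail e k = (if k < 6 then
     [0,
      - 1 / 4 - e / 16 - e ^ 2 / 192 + 11 / 2304 * e ^ 3 + 49 / 18432 * e ^ 4,
      e / 48 + e ^ 2 / 144 + e ^ 3 / 1536 - 7 / 12288 * e ^ 4,
      - (e ^ 2 / 1152) - e ^ 3 / 3072 - e ^ 4 / 30720,
      e ^ 3 / 46080 + e ^ 4 / 115200,
      - (e ^ 4 / 2764800)] ! k else 0)"

definition approx_coeff :: "real \<Rightarrow> nat \<Rightarrow> real" where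
  "approx_coeff e k = (if k = 0 then 1 else e * approx_tail e k)"

text \<open>The exact remainder of the recurrence, divided by \<open>e ^ 6\<close>. Index 6 occurs
  because multiplication by \<open>cos t\<close> carries the last mode, 5, into mode 6.\<close>

definition approx_defect :: "real \<Rightarrow> nat \<Rightarrow> real" where
  "approx_defect e k =
     [- 49 / 36864,
      55 / 73728 - 91 / 147456 * e - 191 / 1769472 * e ^ 2 + 95 / 21233664 * e ^ 3 + 539 / 84934656 * e ^ 4,
      - 719 / 368640 + 73 / 884736 * e + 347 / 10616832 * e ^ 2 + 43 / 14155776 * e ^ 3 - 77 / 56623104 * e ^ 4,
      17 / 51200 + 73 / 4423680 * e - 11 / 53084160 * e ^ 2 - 49 / 70778880 * e ^ 3 - 11 / 141557760 * e ^ 4,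
      1 / 55296 - 13 / 7372800 * e - 29 / 88473600 * e ^ 2 + 31 / 1061683200 * e ^ 3 + 11 / 530841600 * e ^ 4,
      - 1 / 221184 + e / 22118400 + e ^ 2 / 88473600 + e ^ 3 / 1061683200 - 11 / 12740198400 * e ^ 4,
      1 / 5529600] ! k"

lemma less_7_cases: "k < (7::nat) \<longleftrightarrow> k \<in> {0, 1, 2, 3, 4, 5, 6}"
  by auto

text \<open>The coefficients solve, modulo \<open>e ^ 6\<close>, the recurrence for \<open>\<Sum>k. a k * cos ((k + 1/2) t)\<close>,
  normalised by \<open>a 0 = 1\<close>. At \<open>k = 0\<close> the truncated \<open>k - 1 = 0\<close> is intended: the neighbour
  \<open>cos (- t / 2)\<close> is \<open>cos (t / 2)\<close> itself.\<close>

lemma approx_coeff_recurrence: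
  assumes "k < 7"
  shows "- (real k + 1/2)\<^sup>2 * approx_coeff e k =
    e / 2 * (approx_coeff e (k - 1) + approx_coeff e (k + 1)) +
    (lambda_approx e - 1/4) * approx_coeff e k + e ^ 6 * approx_defect e k"
  using assms unfolding less_7_cases
  by (elim insertE emptyE; hypsubst)
     (simp_all add: approx_coeff_def approx_tail_def approx_defect_def lambda_approx_def,
      simp_all add: field_simps eval_nat_numeral)

definition approx_sol :: "real \<Rightarrow> real \<Rightarrow> real" where
  "approx_sol e t = (\<Sum>k<7. approx_coeff e k * cos ((real k + 1/2) * t))"

definition approx_sol' :: "real \<Rightarrow> real \<Rightarrow> real" where
  "approx_sol' e t = (\<Sum>k<7. - (real k + 1/2) * approx_coeff e k * sin ((real k + 1/2) * t))"

definition approx_residual :: "real \<Rightarrow> real \<Rightarrow> real" where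
  "approx_residual e t = (\<Sum>k<7. e ^ 6 * approx_defect e k * cos ((real k + 1/2) * t))"

text \<open>Product-to-sum moves every mode by one in both directions. Nothing leaves the range
  since coefficient 6 is zero, and mode \<open>- 1/2\<close> folds back onto mode
  \<open>1/2\<close>.\<close>

lemma cos_mult_approx_sol:
  "cos t * approx_sol e t =
     (\<Sum>k<7. (approx_coeff e (k - 1) + approx_coeff e (k + 1)) / 2 * cos ((real k + 1/2) * t))"
proof -
  define C where "C k = cos ((real k + 1/2) * t)" for k
  define a where "a = approx_coeff e"
  have C: "cos t * C 0 = (C 0 + C 1) / 2" "cos t * C 1 = (C 0 + C 2) / 2"
    "cos t * C 2 = (C 1 + C 3) / 2" "cos t * C 3 = (C 2 + C 4) / 2"
    "cos t * C 4 = (C 3 + C 5) / 2" "cos t * C 5 = (C 4 + C 6) / 2"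
    using cos_times_cos[of "t / 2" t] cos_times_cos[of "(real 1 + 1/2) * t" t]
      cos_times_cos[of "(real 2 + 1/2) * t" t] cos_times_cos[of "(real 3 + 1/2) * t" t]
      cos_times_cos[of "(real 4 + 1/2) * t" t] cos_times_cos[of "(real 5 + 1/2) * t" t]
    by (simp_all add: C_def algebra_simps)
  have sum7: "(\<Sum>k<7. f k) = f 0 + f 1 + f 2 + f 3 + f 4 + f 5 + f 6" for f :: "nat \<Rightarrow> real"
    by (simp add: eval_nat_numeral)
  have a: "a 6 = 0" "a 7 = 0"
    by (simp_all add: a_def approx_coeff_def approx_tail_def)
  have "cos t * approx_sol e t = (\<Sum>k<7. a k * (cos t * C k))"
    unfolding approx_sol_def a_def C_def sum_distrib_left by (simp add: mult_ac)
  also have "\<dots> = (\<Sum>k<7. (a (k - 1) + a (k + 1)) / 2 * C k)"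
    unfolding sum7 C a by (simp add: a algebra_simps add_divide_distrib flip: numeral_2_eq_2)
  finally show ?thesis
    by (simp add: a_def C_def)
qed

lemma approx_sol_derivatives:
  "(approx_sol e has_real_derivative approx_sol' e t) (at t)"
  "(approx_sol' e has_real_derivative
     (e * cos t + lambda_approx e - 1/4) * approx_sol e t + approx_residual e t) (at t)"
proof -
  let ?C = "\<lambda>k. cos ((real k + 1/2) * t)"
  show "(approx_sol e has_real_derivative approx_sol' e t) (at t)"
    unfolding approx_sol_def approx_sol'_def
    by (rule derivative_eq_intros refl)+ (simp add: algebra_simps)
  have deriv_term: "((\<lambda>t. - w * a * sin (w * t)) has_real_derivative - w\<^sup>2 * a * cos (w * t)) (at t)"
    for w a :: real
    by (auto intro!: derivative_eq_intros simp: power2_eq_square)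
  have "(approx_sol' e has_real_derivative (\<Sum>k<7. - (real k + 1/2)\<^sup>2 * approx_coeff e k * ?C k)) (at t)"
    unfolding approx_sol'_def by (intro DERIV_sum deriv_term)
  also have "(\<Sum>k<7. - (real k + 1/2)\<^sup>2 * approx_coeff e k * ?C k) =
      (\<Sum>k<7. e * ((approx_coeff e (k - 1) + approx_coeff e (k + 1)) / 2 * ?C k) +
        (lambda_approx e - 1/4) * (approx_coeff e k * ?C k) + e ^ 6 * approx_defect e k * ?C k)"
    by (intro sum.cong refl, subst approx_coeff_recurrence) (simp_all add: algebra_simps)
  also have "\<dots> = e * (cos t * approx_sol e t) + (lambda_approx e - 1/4) * approx_sol e t
      + approx_residual e t"
    unfolding cos_mult_approx_sol
    by (simp only: sum.distrib sum_distrib_left[symmetric] approx_sol_def approx_residual_def)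
  finally show "(approx_sol' e has_real_derivative
      (e * cos t + lambda_approx e - 1/4) * approx_sol e t + approx_residual e t) (at t)"
    by (simp add: algebra_simps)
qed

lemma approx_sol_pi: "approx_sol e pi = 0"
proof -
  have "cos ((real k + 1/2) * pi) = 0" for k
    using cos_add[of "real k * pi" "pi / 2"] by (simp add: algebra_simps)
  then show ?thesis by (simp add: approx_sol_def)
qed

lemma approx_sol'_0: "approx_sol' e 0 = 0"
  by (simp add: approx_sol'_def)

lemma bounded_sum_abs_coeffs:
  fixes f :: "real \<Rightarrow> nat \<Rightarrow> real"
  assumes "\<And>k. k < n \<Longrightarrow> continuous_on {-1..1} (\<lambda>e. f e k)"
  obtains K where "K > 0" "\<And>e. \<bar>e\<bar> \<le> 1 \<Longrightarrow> (\<Sum>k<n. \<bar>f e k\<bar>) \<le> K"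
proof -
  have "compact ((\<lambda>e. \<Sum>k<n. \<bar>f e k\<bar>) ` {-1..1})"
    by (intro compact_continuous_image continuous_intros assms) auto
  then obtain K where "K > 0" "\<forall>y\<in>(\<lambda>e. \<Sum>k<n. \<bar>f e k\<bar>) ` {-1..1}. norm y \<le> K"
    using compact_imp_bounded bounded_pos by metis
  then show ?thesis
    by (intro that[of K]) (auto simp: abs_le_iff)
qed

text \<open>Trigonometric factors are at most 1 and polynomial coefficients are bounded on
  \<open>[-1, 1]\<close>; only the split-off powers of \<open>e\<close> remain.\<close>

lemma approx_sol_bounds:
  obtains K where "K > 0"
    "\<And>e t. \<bar>e\<bar> \<le> 1 \<Longrightarrow> \<bar>approx_residual e t\<bar> \<le> K * \<bar>e\<bar> ^ 6"
    "\<And>e t. \<bar>e\<bar> \<le> 1 \<Longrightarrow> \<bar>approx_sol e t - cos (t / 2)\<bar> \<le> K * \<bar>e\<bar>"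
    "\<And>e t. \<bar>e\<bar> \<le> 1 \<Longrightarrow> \<bar>approx_sol' e t + sin (t / 2) / 2\<bar> \<le> K * \<bar>e\<bar>"
proof -
  have cont1: "continuous_on {-1..1} (\<lambda>e. approx_defect e k)" if "k < 7" for k
    using that unfolding less_7_cases
    by (elim insertE emptyE; hypsubst) (auto simp: approx_defect_def intro!: continuous_intros)
  obtain K1 where K1: "K1 > 0"
    "\<And>e. \<bar>e\<bar> \<le> 1 \<Longrightarrow> (\<Sum>k<7. \<bar>approx_defect e k\<bar>) \<le> K1"
    using bounded_sum_abs_coeffs[of 7 approx_defect, OF cont1] by metis
  \<comment> \<open>The weight \<open>real k + 1\<close> dominates both \<open>1\<close> and the
    factor \<open>real k + 1/2\<close> from differentiation, so one constant serves the function and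
    its derivative.\<close>
  have cont2: "continuous_on {-1..1} (\<lambda>e. (real k + 1) * approx_tail e k)" if "k < 7" for k
    using that unfolding less_7_cases
    by (elim insertE emptyE; hypsubst) (auto simp: approx_tail_def intro!: continuous_intros)
  obtain K2 where K2: "K2 > 0"
    "\<And>e. \<bar>e\<bar> \<le> 1 \<Longrightarrow> (\<Sum>k<7. \<bar>(real k + 1) * approx_tail e k\<bar>) \<le> K2"
    using bounded_sum_abs_coeffs[of 7 "\<lambda>e k. (real k + 1) * approx_tail e k", OF cont2] by metis
  have trig: "\<bar>\<Sum>k<7. \<beta> k * \<phi> k\<bar> \<le> (\<Sum>k<7. \<bar>\<beta> k\<bar>)"
    if "\<And>k. \<bar>\<phi> k\<bar> \<le> 1" for \<beta> \<phi> :: "nat \<Rightarrow> real"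
    using that by (intro order_trans[OF sum_abs] sum_mono) (simp add: abs_mult mult_left_le)
  have tail: "(\<Sum>k<7. \<bar>w k * (e * approx_tail e k)\<bar>) \<le> K2 * \<bar>e\<bar>"
    if "\<bar>e\<bar> \<le> 1" "\<And>k. \<bar>w k\<bar> \<le> real k + 1" for e and w :: "nat \<Rightarrow> real"
  proof -
    have "(\<Sum>k<7. \<bar>w k * (e * approx_tail e k)\<bar>) \<le> (\<Sum>k<7. \<bar>(real k + 1) * approx_tail e k\<bar> * \<bar>e\<bar>)"
    proof (rule sum_mono)
      fix k
      show "\<bar>w k * (e * approx_tail e k)\<bar> \<le> \<bar>(real k + 1) * approx_tail e k\<bar> * \<bar>e\<bar>"
        using mult_right_mono[OF that(2), of "\<bar>e\<bar> * \<bar>approx_tail e k\<bar>" k]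
        by (simp add: abs_mult mult_ac)
    qed
    also have "\<dots> \<le> K2 * \<bar>e\<bar>"
      unfolding sum_distrib_right[symmetric] using K2(2)[OF that(1)] by (intro mult_right_mono) auto
    finally show ?thesis .
  qed
  have coeff: "approx_coeff e k = (if k = 0 then 1 else 0) + e * approx_tail e k" for e k
    by (simp add: approx_coeff_def approx_tail_def)
  show ?thesis
  proof (rule that[of "max K1 K2"])
    show "max K1 K2 > 0" using K1 by simp
  next
    fix e t :: real assume e: "\<bar>e\<bar> \<le> 1"
    have mono: "K1 * \<bar>e\<bar> ^ 6 \<le> max K1 K2 * \<bar>e\<bar> ^ 6" "K2 * \<bar>e\<bar> \<le> max K1 K2 * \<bar>e\<bar>"
      by (intro mult_right_mono; simp)+
    have "\<bar>approx_residual e t\<bar> \<le> (\<Sum>k<7. \<bar>e ^ 6 * approx_defect e k\<bar>)"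
      unfolding approx_residual_def by (rule trig) simp
    also have "\<dots> = (\<Sum>k<7. \<bar>approx_defect e k\<bar>) * \<bar>e\<bar> ^ 6"
      unfolding sum_distrib_right by (simp add: abs_mult power_abs mult.commute)
    also have "\<dots> \<le> K1 * \<bar>e\<bar> ^ 6"
      using K1(2)[OF e] by (intro mult_right_mono) auto
    finally show "\<bar>approx_residual e t\<bar> \<le> max K1 K2 * \<bar>e\<bar> ^ 6" using mono by linarith
    have "approx_sol e t = (\<Sum>k<7. (if k = 0 then cos (t / 2) else 0)
        + (1 * (e * approx_tail e k)) * cos ((real k + 1/2) * t))"
      unfolding approx_sol_def coeff by (intro sum.cong) (auto simp: algebra_simps)
    then have "approx_sol e t - cos (t / 2)
        = (\<Sum>k<7. (1 * (e * approx_tail e k)) * cos ((real k + 1/2) * t))"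
      by (simp add: sum.distrib)
    also have "\<bar>\<dots>\<bar> \<le> K2 * \<bar>e\<bar>"
      by (rule order_trans[OF trig tail[OF e]]) simp_all
    finally show "\<bar>approx_sol e t - cos (t / 2)\<bar> \<le> max K1 K2 * \<bar>e\<bar>" using mono by linarith
    have "approx_sol' e t = (\<Sum>k<7. (if k = 0 then - sin (t / 2) / 2 else 0)
        + (- (real k + 1/2) * (e * approx_tail e k)) * sin ((real k + 1/2) * t))"
      unfolding approx_sol'_def coeff by (intro sum.cong) (auto simp: algebra_simps)
    then have "approx_sol' e t + sin (t / 2) / 2
        = (\<Sum>k<7. (- (real k + 1/2) * (e * approx_tail e k)) * sin ((real k + 1/2) * t))"
      by (simp add: sum.distrib)
    also have "\<bar>\<dots>\<bar> \<le> K2 * \<bar>e\<bar>"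
      by (rule order_trans[OF trig tail[OF e]]) simp_all
    finally show "\<bar>approx_sol' e t + sin (t / 2) / 2\<bar> \<le> max K1 K2 * \<bar>e\<bar>" using mono by linarith
  qed
qed

section \<open>The root curve\<close>

text \<open>Here \<open>W\<close> is a Wronskian of two functions whose product \<open>p\<close> is close to \<open>cos\<^sup>2 (t / 2)\<close>; the
  main term is \<open>a\<close> times the integral of \<open>cos\<^sup>2 (t / 2)\<close> over \<open>[0, \<pi>]\<close>.\<close>

lemma integrated_wronskian_bound:
  fixes W p g :: "real \<Rightarrow> real"
  assumes W: "\<And>t. 0 \<le> t \<Longrightarrow> t \<le> pi \<Longrightarrow> (W has_real_derivative a * p t + g t) (at t)"
    and p: "\<And>t. 0 \<le> t \<Longrightarrow> t \<le> pi \<Longrightarrow> \<bar>p t - (cos (t / 2))\<^sup>2\<bar> \<le> 1/4"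
    and g: "\<And>t. 0 \<le> t \<Longrightarrow> t \<le> pi \<Longrightarrow> \<bar>g t\<bar> \<le> m"
  shows "\<bar>W pi - W 0 - a * pi / 2\<bar> \<le> pi * (\<bar>a\<bar> / 4 + m)"
proof -
  have cos2: "(cos (t / 2))\<^sup>2 = 1/2 + cos t / 2" for t :: real
    using cos_double_cos[of "t / 2"] by (simp add: field_simps)
  \<comment> \<open>The subtracted function is a primitive of
    \<open>a * cos\<^sup>2 (t / 2)\<close>, so the mean value theorem for \<open>F\<close> replaces
    integration.\<close>
  define F where "F t = W t - a * (t / 2 + sin t / 2)" for t
  have "(F has_real_derivative a * (p t - (cos (t / 2))\<^sup>2) + g t) (at t)" if "0 \<le> t" "t \<le> pi" for t
    unfolding F_def cos2
    by (auto intro!: derivative_eq_intros W[OF that] simp: algebra_simps)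
  then obtain z where z: "0 < z" "z < pi"
    and eq: "F pi - F 0 = (pi - 0) * (a * (p z - (cos (z / 2))\<^sup>2) + g z)"
    using MVT2[OF pi_gt_zero, of F "\<lambda>t. a * (p t - (cos (t / 2))\<^sup>2) + g t"] by metis
  have "\<bar>a * (p z - (cos (z / 2))\<^sup>2)\<bar> \<le> \<bar>a\<bar> * (1/4)"
    unfolding abs_mult using p[of z] z by (intro mult_left_mono) auto
  then have "\<bar>a * (p z - (cos (z / 2))\<^sup>2) + g z\<bar> \<le> \<bar>a\<bar> / 4 + m"
    using g[of z] z by (intro order_trans[OF abs_triangle_ineq]) linarith
  then have "\<bar>F pi - F 0\<bar> \<le> pi * (\<bar>a\<bar> / 4 + m)"
    unfolding eq abs_mult by (simp add: mult_left_mono)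
  then show ?thesis by (simp add: F_def algebra_simps)
qed

lemma product_near_square:
  fixes x u k :: real
  assumes "\<bar>x - k\<bar> \<le> 1/16" "\<bar>u - k\<bar> \<le> 1/16" "\<bar>k\<bar> \<le> 1"
  shows "\<bar>x * u - k\<^sup>2\<bar> \<le> 1/4"
proof -
  have "x * u - k\<^sup>2 = (x - k) * u + k * (u - k)"
    by (simp add: algebra_simps power2_eq_square)
  moreover have "\<bar>(x - k) * u\<bar> \<le> 1/16 * 2" "\<bar>k * (u - k)\<bar> \<le> 1 * (1/16)"
    unfolding abs_mult using assms by (intro mult_mono; linarith)+
  ultimately show ?thesis by linarith
qed

section \<open>Continuous dependence on the parameters\<close>

lemma mathieu_sol_half_cos: "mathieu_sol 0 0 (\<lambda>t. cos (t / 2)) (\<lambda>t. - sin (t / 2) / 2)"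
  unfolding mathieu_sol_def by (auto intro!: derivative_eq_intros)

text \<open>The difference solves the \<open>(l, e)\<close> equation with a forcing term of size
  \<open>M * (\<bar>l - l2\<bar> + \<bar>e - e2\<bar>)\<close>; smallness of \<open>l\<close> and
  \<open>e\<close> keeps the coefficient below 1, so Gronwall applies with
  \<open>K = 1\<close>.\<close>

lemma mathieu_continuous_dependence:
  assumes xy: "mathieu_sol l e x y" and uv: "mathieu_sol l2 e2 u v"
    and init: "x 0 = u 0" "y 0 = v 0" and le: "\<bar>l\<bar> + \<bar>e\<bar> \<le> 1/2"
    and M: "\<And>t. 0 \<le> t \<Longrightarrow> t \<le> pi \<Longrightarrow> \<bar>u t\<bar> \<le> M" and t: "0 \<le> t" "t \<le> pi"
  shows "\<bar>x t - u t\<bar> \<le> M * (\<bar>l - l2\<bar> + \<bar>e - e2\<bar>) * exp (2 * pi)"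
    and "\<bar>y t - v t\<bar> \<le> M * (\<bar>l - l2\<bar> + \<bar>e - e2\<bar>) * exp (2 * pi)"
proof -
  define \<gamma> where "\<gamma> = M * (\<bar>l - l2\<bar> + \<bar>e - e2\<bar>)"
  have M0: "0 \<le> M" using M[of 0] by simp
  then have \<gamma>0: "0 \<le> \<gamma>" by (simp add: \<gamma>_def)
  have cosb: "\<bar>b * cos s\<bar> \<le> \<bar>b\<bar>" for b s :: real
    by (simp add: abs_mult mult_left_le)
  have D: "((\<lambda>s. x s - u s) has_real_derivative y s - v s) (at s)"
    "((\<lambda>s. y s - v s) has_real_derivative
        (e * cos s + l - 1/4) * x s - (e2 * cos s + l2 - 1/4) * u s) (at s)" for s
    by (intro DERIV_diff mathieu_solD[OF xy] mathieu_solD[OF uv])+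
  have "(x t - u t)\<^sup>2 + (y t - v t)\<^sup>2 \<le> \<gamma>\<^sup>2 * exp ((1 + 2) * t)"
  proof (rule gronwall_second_order[where q = "\<lambda>s. (e * cos s + l - 1/4) * x s - (e2 * cos s + l2 - 1/4) * u s"])
    fix s assume s: "0 \<le> s" "s \<le> t"
    have "\<bar>(e * cos s + l - 1/4) * (x s - u s)\<bar> \<le> 1 * \<bar>x s - u s\<bar>"
      unfolding abs_mult using cosb[of e s] le by (intro mult_right_mono) linarith+
    moreover have "\<bar>((l - l2) + (e - e2) * cos s) * u s\<bar> \<le> (\<bar>l - l2\<bar> + \<bar>e - e2\<bar>) * M"
      unfolding abs_mult using M[of s] M0 s t cosb[of "e - e2" s] abs_triangle_ineq[of "l - l2" "(e - e2) * cos s"]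
      by (intro mult_mono) linarith+
    moreover have "(e * cos s + l - 1/4) * x s - (e2 * cos s + l2 - 1/4) * u s
      = (e * cos s + l - 1/4) * (x s - u s) + ((l - l2) + (e - e2) * cos s) * u s"
      by (simp add: algebra_simps diff_divide_distrib)
    ultimately show "\<bar>(e * cos s + l - 1/4) * x s - (e2 * cos s + l2 - 1/4) * u s\<bar> \<le> 1 * \<bar>x s - u s\<bar> + \<gamma>"
      unfolding \<gamma>_def by (simp add: mult.commute)
  qed (rule D | simp add: t \<gamma>0 init)+
  \<comment> \<open>Rounding \<open>3 * t\<close> up to \<open>4 * pi\<close> makes the bound a
    perfect square.\<close>
  also have "\<dots> \<le> \<gamma>\<^sup>2 * exp (4 * pi)"
    using t by (intro mult_left_mono) auto
  also have "\<dots> = (\<gamma> * exp (2 * pi))\<^sup>2"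
    by (simp add: power_mult_distrib flip: exp_double)
  finally have *: "(x t - u t)\<^sup>2 + (y t - v t)\<^sup>2 \<le> (\<gamma> * exp (2 * pi))\<^sup>2" .
  have "(x t - u t)\<^sup>2 \<le> (\<gamma> * exp (2 * pi))\<^sup>2" "(y t - v t)\<^sup>2 \<le> (\<gamma> * exp (2 * pi))\<^sup>2"
    using * zero_le_power2[of "x t - u t"] zero_le_power2[of "y t - v t"] by linarith+
  then show "\<bar>x t - u t\<bar> \<le> M * (\<bar>l - l2\<bar> + \<bar>e - e2\<bar>) * exp (2 * pi)"
    "\<bar>y t - v t\<bar> \<le> M * (\<bar>l - l2\<bar> + \<bar>e - e2\<bar>) * exp (2 * pi)"
    unfolding \<gamma>_def[symmetric] using \<gamma>0 by (simp_all add: abs_le_square_iff[symmetric])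
qed

text \<open>For parameters up to this radius, the factor \<open>exp (2 * pi)\<close> of
  \<open>mathieu_continuous_dependence\<close> still leaves an error of at most \<open>1/16\<close>.\<close>

definition param_radius :: real where
  "param_radius = exp (- (2 * pi)) / 32"

lemma param_radius: "0 < param_radius" "param_radius \<le> 1/32" "param_radius * exp (2 * pi) = 1/32"
  by (simp_all add: param_radius_def flip: exp_add)

section \<open>Even solutions compared across parameters\<close>

locale even_mathieu_family =
  fixes E E' :: "real \<Rightarrow> real \<Rightarrow> real \<Rightarrow> real"
  assumes sol: "mathieu_sol l e (E l e) (E' l e)" and init: "E l e 0 = 1" "E' l e 0 = 0"
begin

lemma near_half_cos:
  assumes "\<bar>l\<bar> \<le> param_radius" "\<bar>e\<bar> \<le> param_radius" "0 \<le> t" "t \<le> pi"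
  shows "\<bar>E l e t - cos (t / 2)\<bar> \<le> 1/16" "\<bar>E' l e t + sin (t / 2) / 2\<bar> \<le> 1/16"
proof -
  have "(\<bar>l\<bar> + \<bar>e\<bar>) * exp (2 * pi) \<le> (2 * param_radius) * exp (2 * pi)"
    using assms by (intro mult_right_mono) auto
  also have "\<dots> = 1/16" using param_radius(3) by simp
  finally have "(\<bar>l\<bar> + \<bar>e\<bar>) * exp (2 * pi) \<le> 1/16" .
  moreover have "\<bar>l\<bar> + \<bar>e\<bar> \<le> 1/2" using assms param_radius(2) by linarith
  note mathieu_continuous_dependence[OF sol mathieu_sol_half_cos _ _ this _ assms(3,4), of 1]
  ultimately show "\<bar>E l e t - cos (t / 2)\<bar> \<le> 1/16" "\<bar>E' l e t + sin (t / 2) / 2\<bar> \<le> 1/16"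
    by (simp_all add: init)
qed

text \<open>The reference values at \<open>pi\<close> are \<open>0\<close> and \<open>- 1/2\<close>;
  in particular \<open>E'\<close> keeps a negative sign there.\<close>

lemma half_period_bounds:
  assumes "\<bar>l\<bar> \<le> param_radius" "\<bar>e\<bar> \<le> param_radius"
  shows "\<bar>E l e pi\<bar> \<le> 1/16" "E' l e pi \<le> - 7/16" "- 9/16 \<le> E' l e pi"
  using near_half_cos[OF assms pi_ge_zero order_refl, unfolded cos_pi_half sin_pi_half]
  by linarith+

text \<open>The Wronskian has derivative \<open>(l1 - l2) + (e1 - e2) * cos t\<close> times the
  product of the solutions. Equal \<open>e\<close> will give the sign change at a root, two roots
  the Lipschitz bound.\<close>

lemma two_parameter_wronskian:
  assumes "\<bar>l1\<bar> \<le> param_radius" "\<bar>e1\<bar> \<le> param_radius" "\<bar>l2\<bar> \<le> param_radius" "\<bar>e2\<bar> \<le> param_radius"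
  shows "\<bar>E' l1 e1 pi * E l2 e2 pi - E l1 e1 pi * E' l2 e2 pi - (l1 - l2) * pi / 2\<bar>
    \<le> pi * (\<bar>l1 - l2\<bar> / 4 + 2 * \<bar>e1 - e2\<bar>)"
proof -
  let ?W = "\<lambda>t. E' l1 e1 t * E l2 e2 t - E l1 e1 t * E' l2 e2 t"
  have prod: "\<bar>E l1 e1 t * E l2 e2 t - (cos (t / 2))\<^sup>2\<bar> \<le> 1/4" if "0 \<le> t" "t \<le> pi" for t
    using near_half_cos that assms by (intro product_near_square) auto
  have "\<bar>?W pi - ?W 0 - (l1 - l2) * pi / 2\<bar> \<le> pi * (\<bar>l1 - l2\<bar> / 4 + 2 * \<bar>e1 - e2\<bar>)"
  proof (rule integrated_wronskian_bound)
    fix t assume t: "0 \<le> t" "t \<le> pi"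
    show "(?W has_real_derivative
        (l1 - l2) * (E l1 e1 t * E l2 e2 t) + (e1 - e2) * cos t * (E l1 e1 t * E l2 e2 t)) (at t)"
      by (rule derivative_eq_intros mathieu_solD[OF sol] refl)+ (simp add: algebra_simps)
    show "\<bar>E l1 e1 t * E l2 e2 t - (cos (t / 2))\<^sup>2\<bar> \<le> 1/4"
      by (rule prod[OF t])
    have "(cos (t / 2))\<^sup>2 \<le> 1" by (simp add: abs_square_le_1)
    then have "\<bar>E l1 e1 t * E l2 e2 t\<bar> \<le> 2"
      using prod[OF t] zero_le_power2[of "cos (t / 2)"] by linarith
    moreover have "\<bar>(e1 - e2) * cos t\<bar> \<le> \<bar>e1 - e2\<bar>"
      by (simp add: abs_mult mult_left_le)
    ultimately have "\<bar>(e1 - e2) * cos t\<bar> * \<bar>E l1 e1 t * E l2 e2 t\<bar> \<le> \<bar>e1 - e2\<bar> * 2"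
      by (intro mult_mono) auto
    then show "\<bar>(e1 - e2) * cos t * (E l1 e1 t * E l2 e2 t)\<bar> \<le> 2 * \<bar>e1 - e2\<bar>"
      by (simp add: abs_mult)
  qed
  then show ?thesis by (simp add: init)
qed

text \<open>At the root only \<open>- E l e pi * E' f e pi\<close> survives in the Wronskian; its
  main term is twice the error bound, and \<open>E' f e pi\<close> is negative.\<close>

lemma half_period_sign:
  assumes "\<bar>l\<bar> \<le> param_radius" "\<bar>f\<bar> \<le> param_radius" "\<bar>e\<bar> \<le> param_radius" and root: "E f e pi = 0"
  shows "l > f \<Longrightarrow> E l e pi > 0" "l < f \<Longrightarrow> E l e pi < 0"
proof -
  define D Z where "D = (l - f) * pi" and "Z = E l e pi * E' f e pi"
  have "\<bar>- Z - D / 2\<bar> \<le> \<bar>D\<bar> / 4"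
    using two_parameter_wronskian[OF assms(1,3,2,3)] root
    by (simp add: D_def Z_def abs_mult mult.commute)
  then have Z: "D > 0 \<Longrightarrow> Z < 0" "D < 0 \<Longrightarrow> Z > 0" by linarith+
  have neg: "E' f e pi < 0" using half_period_bounds[OF assms(2,3)] by linarith
  show "E l e pi > 0" if "l > f"
    using Z(1) that neg by (simp add: D_def Z_def mult_less_0_iff)
  show "E l e pi < 0" if "l < f"
    using Z(2) that neg by (simp add: D_def Z_def zero_less_mult_iff mult_less_0_iff)
qed

text \<open>At two roots the Wronskian vanishes, so the main term is bounded by the errors;
  \<open>8 = 2 / (1/2 - 1/4)\<close>.\<close>

lemma root_lipschitz:
  assumes "\<bar>l1\<bar> \<le> param_radius" "\<bar>e1\<bar> \<le> param_radius" "\<bar>l2\<bar> \<le> param_radius" "\<bar>e2\<bar> \<le> param_radius"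
    and "E l1 e1 pi = 0" "E l2 e2 pi = 0"
  shows "\<bar>l1 - l2\<bar> \<le> 8 * \<bar>e1 - e2\<bar>"
proof -
  have "\<bar>l1 - l2\<bar> * pi / 2 \<le> pi * (\<bar>l1 - l2\<bar> / 4 + 2 * \<bar>e1 - e2\<bar>)"
    using two_parameter_wronskian[OF assms(1-4)] assms(5,6) by (simp add: abs_mult)
  then have "pi * (\<bar>l1 - l2\<bar> / 2) \<le> pi * (\<bar>l1 - l2\<bar> / 4 + 2 * \<bar>e1 - e2\<bar>)"
    by (simp add: algebra_simps)
  then have "\<bar>l1 - l2\<bar> / 2 \<le> \<bar>l1 - l2\<bar> / 4 + 2 * \<bar>e1 - e2\<bar>"
    by (rule mult_left_le_imp_le) simp
  then show ?thesis by simp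
qed

lemma continuous_half_period:
  assumes "\<bar>e\<bar> \<le> param_radius"
  shows "continuous_on {- param_radius..param_radius} (\<lambda>l. E l e pi)"
proof (rule lipschitz_on_continuous_on[of "2 * exp (2 * pi)"], rule lipschitz_onI)
  fix l1 l2 assume "l1 \<in> {- param_radius..param_radius}" "l2 \<in> {- param_radius..param_radius}"
  then have l: "\<bar>l1\<bar> \<le> param_radius" "\<bar>l2\<bar> \<le> param_radius" by auto
  have "\<bar>E l2 e t\<bar> \<le> 2" if "0 \<le> t" "t \<le> pi" for t
    using near_half_cos(1)[OF l(2) assms that] abs_cos_le_one[of "t / 2"] by linarith
  moreover have "\<bar>l1\<bar> + \<bar>e\<bar> \<le> 1/2" using l assms param_radius(2) by linarith
  ultimately have "\<bar>E l1 e pi - E l2 e pi\<bar> \<le> 2 * (\<bar>l1 - l2\<bar> + \<bar>e - e\<bar>) * exp (2 * pi)"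
    by (intro mathieu_continuous_dependence[OF sol sol]) (auto simp: init)
  then show "dist (E l1 e pi) (E l2 e pi) \<le> 2 * exp (2 * pi) * dist l1 l2"
    by (simp add: dist_real_def mult_ac)
qed simp

text \<open>Since \<open>approx_sol\<close> vanishes at \<open>pi\<close>, its Wronskian with
  \<open>E l e\<close> there is \<open>approx_sol' e pi * E l e pi\<close>. Its main term has the
  sign of \<open>lambda_approx e - l\<close>, and the residual costs \<open>O(e ^ 6)\<close>; the
  intermediate value theorem then finds the root.\<close>

lemma root_near_lambda_approx:
  obtains \<epsilon>\<^sub>0 K where "0 < \<epsilon>\<^sub>0" "\<epsilon>\<^sub>0 \<le> param_radius" "0 < K"
    "\<And>e. \<bar>e\<bar> \<le> \<epsilon>\<^sub>0 \<Longrightarrow> \<exists>f. \<bar>f\<bar> \<le> param_radius \<and> \<bar>f - lambda_approx e\<bar> \<le> K * \<bar>e\<bar> ^ 6 \<and> E f e pi = 0"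
proof -
  obtain K where K: "K > 0"
    and res: "\<And>e t. \<bar>e\<bar> \<le> 1 \<Longrightarrow> \<bar>approx_residual e t\<bar> \<le> K * \<bar>e\<bar> ^ 6"
    and near: "\<And>e t. \<bar>e\<bar> \<le> 1 \<Longrightarrow> \<bar>approx_sol e t - cos (t / 2)\<bar> \<le> K * \<bar>e\<bar>"
      "\<And>e t. \<bar>e\<bar> \<le> 1 \<Longrightarrow> \<bar>approx_sol' e t + sin (t / 2) / 2\<bar> \<le> K * \<bar>e\<bar>"
    by (rule approx_sol_bounds) blast
  \<comment> \<open>Chosen so that \<open>lambda_approx e\<close>, of size at most
    \<open>\<bar>e\<bar>\<close>, plus or minus \<open>8 * K * \<bar>e\<bar> ^ 6\<close> stays
    within \<open>param_radius\<close>, and \<open>K * \<bar>e\<bar> \<le> 1/16\<close>.\<close>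
  define \<epsilon>\<^sub>0 where "\<epsilon>\<^sub>0 = param_radius / (1 + 16 * K)"
  have \<epsilon>\<^sub>0: "0 < \<epsilon>\<^sub>0" "\<epsilon>\<^sub>0 \<le> param_radius" "\<epsilon>\<^sub>0 * (1 + 16 * K) = param_radius"
    unfolding \<epsilon>\<^sub>0_def using K param_radius(1) by (auto simp: field_simps)
  have "\<exists>f. \<bar>f\<bar> \<le> param_radius \<and> \<bar>f - lambda_approx e\<bar> \<le> (8 * K) * \<bar>e\<bar> ^ 6 \<and> E f e pi = 0"
    if e: "\<bar>e\<bar> \<le> \<epsilon>\<^sub>0" for e
  proof -
    define g where "g = lambda_approx e"
    have er: "\<bar>e\<bar> \<le> param_radius" using e \<epsilon>\<^sub>0 by linarith
    have e1: "\<bar>e\<bar> \<le> 1" using er param_radius(2) by linarith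
    have eK: "\<bar>e\<bar> + 16 * (K * \<bar>e\<bar>) \<le> param_radius"
      using mult_right_mono[OF e, of "1 + 16 * K"] K \<epsilon>\<^sub>0(3) by (simp add: algebra_simps)
    have Ke: "K * \<bar>e\<bar> \<le> 1/16" using eK param_radius(2) by linarith
    have e6: "K * \<bar>e\<bar> ^ 6 \<le> K * \<bar>e\<bar>"
      using power_decreasing[of 1 6 "\<bar>e\<bar>"] e1 K by simp
    have gb: "\<bar>g\<bar> \<le> \<bar>e\<bar>"
    proof -
      have "\<bar>e ^ n\<bar> \<le> \<bar>e\<bar>" if "1 \<le> n" for n
        using power_decreasing[of 1 n "\<bar>e\<bar>"] e1 that by (simp add: power_abs)
      from this[of 2] this[of 3] this[of 4] this[of 5] show ?thesis
        unfolding g_def lambda_approx_def by linarith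
    qed
    have W: "\<bar>approx_sol' e pi * E l e pi - (g - l) * pi / 2\<bar> \<le> pi * (\<bar>g - l\<bar> / 4 + 2 * (K * \<bar>e\<bar> ^ 6))"
      if l: "\<bar>l\<bar> \<le> param_radius" for l
    proof -
      let ?W = "\<lambda>t. approx_sol' e t * E l e t - approx_sol e t * E' l e t"
      have "\<bar>?W pi - ?W 0 - (g - l) * pi / 2\<bar> \<le> pi * (\<bar>g - l\<bar> / 4 + 2 * (K * \<bar>e\<bar> ^ 6))"
      proof (rule integrated_wronskian_bound)
        fix t assume t: "0 \<le> t" "t \<le> pi"
        show "(?W has_real_derivative
            (g - l) * (approx_sol e t * E l e t) + approx_residual e t * E l e t) (at t)"
          unfolding g_def
          by (rule derivative_eq_intros mathieu_solD[OF sol] approx_sol_derivatives refl)+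
             (simp add: algebra_simps)
        show "\<bar>approx_sol e t * E l e t - (cos (t / 2))\<^sup>2\<bar> \<le> 1/4"
          using near(1)[OF e1, of t] Ke near_half_cos(1)[OF l er t]
          by (intro product_near_square) auto
        have "\<bar>E l e t\<bar> \<le> 2"
          using near_half_cos(1)[OF l er t] abs_cos_le_one[of "t / 2"] by linarith
        then have "\<bar>approx_residual e t\<bar> * \<bar>E l e t\<bar> \<le> (K * \<bar>e\<bar> ^ 6) * 2"
          using res[OF e1, of t] K by (intro mult_mono) auto
        then show "\<bar>approx_residual e t * E l e t\<bar> \<le> 2 * (K * \<bar>e\<bar> ^ 6)"
          by (simp add: abs_mult)
      qed
      then show ?thesis by (simp add: init approx_sol_pi approx_sol'_0)
    qed
    have neg: "approx_sol' e pi < 0"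
      using near(2)[OF e1, of pi] Ke by simp
    \<comment> \<open>At distance \<open>?d\<close> from \<open>g\<close> the main term
      \<open>?d / 2\<close> exactly equals the error bound
      \<open>?d / 4 + 2 * K * \<bar>e\<bar> ^ 6\<close>, up to the common factor \<open>pi\<close>;
      this settles the signs weakly.\<close>
    let ?d = "8 * (K * \<bar>e\<bar> ^ 6)"
    have d0: "0 \<le> ?d" using K by simp
    have lo: "\<bar>g - ?d\<bar> \<le> param_radius" and hi: "\<bar>g + ?d\<bar> \<le> param_radius"
      using gb eK e6 d0 K by linarith+
    have "0 \<le> approx_sol' e pi * E (g - ?d) e pi"
      using W[OF lo] d0 by (simp add: abs_le_iff algebra_simps)
    then have "E (g - ?d) e pi \<le> 0" using neg by (simp add: zero_le_mult_iff)
    moreover have "approx_sol' e pi * E (g + ?d) e pi \<le> 0"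
      using W[OF hi] d0 by (simp add: abs_le_iff algebra_simps)
    then have "0 \<le> E (g + ?d) e pi" using neg by (simp add: mult_le_0_iff)
    moreover have "continuous_on {g - ?d..g + ?d} (\<lambda>l. E l e pi)"
      using lo hi by (intro continuous_on_subset[OF continuous_half_period[OF er]]) auto
    ultimately obtain f where "g - ?d \<le> f" "f \<le> g + ?d" "E f e pi = 0"
      using IVT'[of "\<lambda>l. E l e pi" "g - ?d" 0 "g + ?d"] d0 by force
    then show ?thesis
      using lo hi by (intro exI[of _ f]) (auto simp: g_def abs_le_iff)
  qed
  then show ?thesis using that[of \<epsilon>\<^sub>0 "8 * K"] \<epsilon>\<^sub>0 K by simp
qed

text \<open>Choosing roots pointwise is harmless: \<open>half_period_sign\<close> makes the root
  within the radius unique, and continuity will follow from \<open>root_lipschitz\<close>.\<close>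

lemma root_curve:
  obtains \<epsilon>\<^sub>0 K f where "0 < \<epsilon>\<^sub>0" "\<epsilon>\<^sub>0 \<le> param_radius"
    "\<And>e. \<bar>e\<bar> \<le> \<epsilon>\<^sub>0 \<Longrightarrow> \<bar>f e\<bar> \<le> param_radius"
    "\<And>e. \<bar>e\<bar> \<le> \<epsilon>\<^sub>0 \<Longrightarrow> \<bar>f e - lambda_approx e\<bar> \<le> K * \<bar>e\<bar> ^ 6"
    "\<And>e. \<bar>e\<bar> \<le> \<epsilon>\<^sub>0 \<Longrightarrow> E (f e) e pi = 0"
proof -
  obtain \<epsilon>\<^sub>0 K where \<epsilon>\<^sub>0: "0 < \<epsilon>\<^sub>0" "\<epsilon>\<^sub>0 \<le> param_radius"
    and ex: "\<And>e. \<bar>e\<bar> \<le> \<epsilon>\<^sub>0 \<Longrightarrow>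
      \<exists>f. \<bar>f\<bar> \<le> param_radius \<and> \<bar>f - lambda_approx e\<bar> \<le> K * \<bar>e\<bar> ^ 6 \<and> E f e pi = 0"
    by (rule root_near_lambda_approx) blast
  define f where
    "f e = (SOME f. \<bar>f\<bar> \<le> param_radius \<and> \<bar>f - lambda_approx e\<bar> \<le> K * \<bar>e\<bar> ^ 6 \<and> E f e pi = 0)" for e
  have "\<bar>f e\<bar> \<le> param_radius \<and> \<bar>f e - lambda_approx e\<bar> \<le> K * \<bar>e\<bar> ^ 6 \<and> E (f e) e pi = 0"
    if "\<bar>e\<bar> \<le> \<epsilon>\<^sub>0" for e
    unfolding f_def by (rule someI_ex[OF ex[OF that]])
  with \<epsilon>\<^sub>0 show ?thesis using that[of \<epsilon>\<^sub>0 f K] by blast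
qed

text \<open>\<open>E l e pi\<close> has the sign of \<open>l - f\<close>, and
  \<open>s' pi = E l (- e) pi\<close> that of \<open>l - g\<close>, so the product decides. For
  stability it must also stay below 1, which holds as both factors are at most \<open>1/16\<close>
  in size.\<close>

lemma stability_by_roots:
  assumes l: "\<bar>l\<bar> \<le> param_radius" and e: "\<bar>e\<bar> \<le> param_radius"
    and f: "\<bar>f\<bar> \<le> param_radius" "E f e pi = 0"
    and g: "\<bar>g\<bar> \<le> param_radius" "E g (- e) pi = 0"
    and l_def: "l = \<alpha> - (\<mu> - 1) / 4"
  shows "(l - f) * (l - g) < 0 \<Longrightarrow> unstable_system (pendulum_H \<mu> \<alpha> e)"
    and "(l - f) * (l - g) > 0 \<Longrightarrow> stable_system (pendulum_H \<mu> \<alpha> e)"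
proof -
  obtain s s' where s: "mathieu_sol l e s s'" "s 0 = 0" "s' 0 = 1"
    by (rule mathieu_sol_exists)
  interpret mathieu_fundamental l e "E l e" "E' l e" s s'
    by unfold_locales (simp_all add: sol init s)
  have me: "\<bar>- e\<bar> \<le> param_radius" using e by simp
  have s': "s' pi = E l (- e) pi"
    by (rule s'_pi_eq_even_solution_shifted[OF sol init])
  have sgn1: "l > f \<Longrightarrow> E l e pi > 0" "l < f \<Longrightarrow> E l e pi < 0"
    using half_period_sign[OF l f(1) e f(2)] by blast+
  have sgn2: "l > g \<Longrightarrow> s' pi > 0" "l < g \<Longrightarrow> s' pi < 0"
    unfolding s' using half_period_sign[OF l g(1) me g(2)] by blast+
  show "unstable_system (pendulum_H \<mu> \<alpha> e)" if "(l - f) * (l - g) < 0"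
    using that sgn1 sgn2 by (intro unstable_system_if[OF _ l_def]) (auto simp: mult_less_0_iff)
  have "\<bar>E l e pi\<bar> * \<bar>s' pi\<bar> \<le> 1/16 * (1/16)"
    unfolding s' using half_period_bounds(1)[OF l e] half_period_bounds(1)[OF l me]
    by (intro mult_mono) auto
  then have "E l e pi * s' pi < 1"
    using abs_ge_self[of "E l e pi * s' pi"] unfolding abs_mult by linarith
  then show "stable_system (pendulum_H \<mu> \<alpha> e)" if "(l - f) * (l - g) > 0"
    using that sgn1 sgn2 by (intro stable_system_if[OF _ _ l_def]) (auto simp: zero_less_mult_iff)
qed

end

section \<open>The two boundary curves\<close>

lemma even_mathieu_family_exists:
  obtains E E' where "even_mathieu_family E E'"
proof -
  have "\<forall>l e. \<exists>x y. mathieu_sol l e x y \<and> x 0 = 1 \<and> y 0 = 0"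
    using mathieu_sol_exists by blast
  then obtain E where "\<forall>l e. \<exists>y. mathieu_sol l e (E l e) y \<and> E l e 0 = 1 \<and> y 0 = 0"
    by metis
  then obtain E' where "\<forall>l e. mathieu_sol l e (E l e) (E' l e) \<and> E l e 0 = 1 \<and> E' l e 0 = 0"
    by metis
  then show ?thesis using that[of E E'] by (simp add: even_mathieu_family_def)
qed

theorem mainTheorem5:
  "\<exists>\<alpha>\<^sub>m \<alpha>\<^sub>p :: real \<Rightarrow> real \<Rightarrow> real. \<forall>\<mu>.
     boundary_emanating_from (pendulum_H \<mu>) ((\<mu> - 1) / 4) (\<alpha>\<^sub>m \<mu>) (\<alpha>\<^sub>p \<mu>) \<and>
     (\<lambda>\<epsilon>. \<alpha>\<^sub>m \<mu> \<epsilon> - ((\<mu> - 1) / 4 - \<epsilon> / 2 + \<epsilon> ^ 2 / 8 + \<epsilon> ^ 3 / 32 + \<epsilon> ^ 4 / 384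
                      - 11 / 4608 * \<epsilon> ^ 5)) \<in> O[at_right 0](\<lambda>\<epsilon>. \<epsilon> ^ 6) \<and>
     (\<lambda>\<epsilon>. \<alpha>\<^sub>p \<mu> \<epsilon> - ((\<mu> - 1) / 4 + \<epsilon> / 2 + \<epsilon> ^ 2 / 8 - \<epsilon> ^ 3 / 32 + \<epsilon> ^ 4 / 384
                      + 11 / 4608 * \<epsilon> ^ 5)) \<in> O[at_right 0](\<lambda>\<epsilon>. \<epsilon> ^ 6)"
proof -
  obtain E E' where "even_mathieu_family E E'" by (rule even_mathieu_family_exists)
  then interpret even_mathieu_family E E' .
  obtain \<epsilon>\<^sub>0 K f where \<epsilon>\<^sub>0: "0 < \<epsilon>\<^sub>0" "\<epsilon>\<^sub>0 \<le> param_radius"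
    and f: "\<And>e. \<bar>e\<bar> \<le> \<epsilon>\<^sub>0 \<Longrightarrow> \<bar>f e\<bar> \<le> param_radius"
      "\<And>e. \<bar>e\<bar> \<le> \<epsilon>\<^sub>0 \<Longrightarrow> \<bar>f e - lambda_approx e\<bar> \<le> K * \<bar>e\<bar> ^ 6"
      "\<And>e. \<bar>e\<bar> \<le> \<epsilon>\<^sub>0 \<Longrightarrow> E (f e) e pi = 0"
    by (rule root_curve) blast
  \<comment> \<open>Neither \<open>f\<close> nor \<open>\<epsilon>\<^sub>0\<close> depends on
    \<open>\<mu>\<close>, which only translates \<open>\<alpha>\<close>. Roots of
    \<open>c pi\<close> give \<open>a\<close>; roots of \<open>s' pi\<close>, by the shift symmetry,
    give \<open>b\<close>.\<close>
  define a where "a \<mu> e = (\<mu> - 1) / 4 + f e" for \<mu> e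
  define b where "b \<mu> e = (\<mu> - 1) / 4 + f (- e)" for \<mu> e
  \<comment> \<open>At \<open>e = 0\<close> the error bound is zero, which forces
    \<open>f 0 = lambda_approx 0\<close>.\<close>
  have f0: "f 0 = 0" using f(2)[of 0] \<epsilon>\<^sub>0 by (simp add: lambda_approx_def)
  have "8-lipschitz_on {- \<epsilon>\<^sub>0..\<epsilon>\<^sub>0} f"
  proof (rule lipschitz_onI)
    fix x y assume "x \<in> {- \<epsilon>\<^sub>0..\<epsilon>\<^sub>0}" "y \<in> {- \<epsilon>\<^sub>0..\<epsilon>\<^sub>0}"
    then have "\<bar>x\<bar> \<le> \<epsilon>\<^sub>0" "\<bar>y\<bar> \<le> \<epsilon>\<^sub>0" by auto
    then show "dist (f x) (f y) \<le> 8 * dist x y"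
      unfolding dist_real_def using f \<epsilon>\<^sub>0 by (intro root_lipschitz) force+
  qed simp
  then have cont: "continuous_on {- \<epsilon>\<^sub>0..\<epsilon>\<^sub>0} f" by (rule lipschitz_on_continuous_on)
  have cont_a: "continuous_on {0..<\<epsilon>\<^sub>0} (a \<mu>)" and cont_b: "continuous_on {0..<\<epsilon>\<^sub>0} (b \<mu>)" for \<mu>
    unfolding a_def b_def using \<epsilon>\<^sub>0
    by (auto intro!: continuous_intros continuous_on_subset[OF cont]
        continuous_on_compose2[OF cont, of _ uminus])
  have near: "eventually (\<lambda>e. 0 < e \<and> e < \<epsilon>\<^sub>0) (at_right 0)"
    using \<epsilon>\<^sub>0 by (auto simp: eventually_at_right intro: exI[of _ \<epsilon>\<^sub>0])
  have "boundary_emanating_from (pendulum_H \<mu>) ((\<mu> - 1) / 4) (a \<mu>) (b \<mu>)" for \<mu>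
    unfolding boundary_emanating_from_def
  proof (rule exI[of _ \<epsilon>\<^sub>0], intro conjI \<epsilon>\<^sub>0, rule exI[of _ param_radius], intro conjI param_radius
      cont_a cont_b allI impI)
    fix \<epsilon> \<alpha> :: real
    assume \<epsilon>: "0 < \<epsilon>" "\<epsilon> < \<epsilon>\<^sub>0" and \<alpha>: "\<bar>\<alpha> - (\<mu> - 1) / 4\<bar> < param_radius"
    define l where "l = \<alpha> - (\<mu> - 1) / 4"
    have \<epsilon>': "\<bar>\<epsilon>\<bar> \<le> \<epsilon>\<^sub>0" "\<bar>- \<epsilon>\<bar> \<le> \<epsilon>\<^sub>0" and l: "\<bar>l\<bar> \<le> param_radius" and er: "\<bar>\<epsilon>\<bar> \<le> param_radius"
      using \<epsilon> \<alpha> \<epsilon>\<^sub>0 by (auto simp: l_def)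
    note S = stability_by_roots[OF l er f(1)[OF \<epsilon>'(1)] f(3)[OF \<epsilon>'(1)] f(1)[OF \<epsilon>'(2)] f(3)[OF \<epsilon>'(2)] l_def]
    \<comment> \<open>Strictly between the curves the factors \<open>l - f \<epsilon>\<close> and
      \<open>l - f (- \<epsilon>)\<close> have opposite signs, outside them equal signs, whatever
      the order of the curves.\<close>
    show "unstable_system (pendulum_H \<mu> \<alpha> \<epsilon>)" if "\<alpha> \<in> open_segment (a \<mu> \<epsilon>) (b \<mu> \<epsilon>)"
      using that by (intro S(1))
        (auto simp: l_def a_def b_def open_segment_eq_real_ivl mult_less_0_iff split: if_splits)
    show "stable_system (pendulum_H \<mu> \<alpha> \<epsilon>)" if "\<alpha> \<notin> closed_segment (a \<mu> \<epsilon>) (b \<mu> \<epsilon>)"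
      using that by (intro S(2))
        (auto simp: l_def a_def b_def closed_segment_eq_real_ivl zero_less_mult_iff split: if_splits)
  qed (simp_all add: a_def b_def f0)
  moreover have "(\<lambda>\<epsilon>. a \<mu> \<epsilon> - ((\<mu> - 1) / 4 - \<epsilon> / 2 + \<epsilon> ^ 2 / 8 + \<epsilon> ^ 3 / 32 + \<epsilon> ^ 4 / 384
      - 11 / 4608 * \<epsilon> ^ 5)) \<in> O[at_right 0](\<lambda>\<epsilon>. \<epsilon> ^ 6)" for \<mu>
  proof (rule bigoI[of _ K], rule eventually_mono[OF near])
    fix \<epsilon> :: real assume "0 < \<epsilon> \<and> \<epsilon> < \<epsilon>\<^sub>0"
    then show "norm (a \<mu> \<epsilon> - ((\<mu> - 1) / 4 - \<epsilon> / 2 + \<epsilon> ^ 2 / 8 + \<epsilon> ^ 3 / 32 + \<epsilon> ^ 4 / 384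
        - 11 / 4608 * \<epsilon> ^ 5)) \<le> K * norm (\<epsilon> ^ 6)"
      using f(2)[of \<epsilon>] by (simp add: a_def lambda_approx_def power_abs algebra_simps)
  qed
  moreover have "(\<lambda>\<epsilon>. b \<mu> \<epsilon> - ((\<mu> - 1) / 4 + \<epsilon> / 2 + \<epsilon> ^ 2 / 8 - \<epsilon> ^ 3 / 32 + \<epsilon> ^ 4 / 384
      + 11 / 4608 * \<epsilon> ^ 5)) \<in> O[at_right 0](\<lambda>\<epsilon>. \<epsilon> ^ 6)" for \<mu>
  proof (rule bigoI[of _ K], rule eventually_mono[OF near])
    fix \<epsilon> :: real assume "0 < \<epsilon> \<and> \<epsilon> < \<epsilon>\<^sub>0"
    then show "norm (b \<mu> \<epsilon> - ((\<mu> - 1) / 4 + \<epsilon> / 2 + \<epsilon> ^ 2 / 8 - \<epsilon> ^ 3 / 32 + \<epsilon> ^ 4 / 384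
        + 11 / 4608 * \<epsilon> ^ 5)) \<le> K * norm (\<epsilon> ^ 6)"
      using f(2)[of "- \<epsilon>"] by (simp add: b_def lambda_approx_def power_abs algebra_simps)
  qed
  ultimately show ?thesis by blast
qed

end
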